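(* Let $n\ge2$, let $L$ be an infinitely smooth origin-symmetric convex body in $\mathbb R^n$ with positive curvature, and let $f_{n-1},g\in C^2(\mathbb R^n\setminus\{0\})$ be even functions such that $f_{n-1}$ is strictly positive on $\mathbb R^n\setminus\{0\}$. For $\varepsilon>0$ define a star-shaped body $D$ by the following equation for its radial function $\|x\|_D^{-1}$: $$\int_0^{\|x\|_D^{-1}}t^{n-2}f_{n-1}(tx)\,dt=\int_0^{\|x\|_L^{-1}}t^{n-2}f_{n-1}(tx)\,dt-\varepsilon g(x),\qquad\forall x\in S^{n-1}.$$ Then, if $\varepsilon$ is small enough, the body $D$ is convex.
   Context: For a body $K$ star-shaped with respect to the origin, $\|x\|_K=\min\{a>0:x\in aK\}$ (for $x\neq 0$) is its Minkowski functional, and $\|x\|_K^{-1}$, $x\in S^{n-1}$, is its radial function. A convex body is a compact convex set with non-empty interior. "Infinitely smooth with positive curvature" means that the boundary is a $C^\infty$ hypersurface with everywhere positive Gaussian curvature. The integrals $\int_0^R t^{n-2}f_{n-1}(tx)\,dt$, $x\in S^{n-1}$, $R>0$, are assumed finite (standing local integrability of $f_{n-1}$). *)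

theory Defs
  imports "HOL-Analysis.Analysis"
begin

(* Only meant for open S, where the directional derivatives are determined by f on S. *)
primrec Ck_on :: "nat \<Rightarrow> ('a::euclidean_space \<Rightarrow> 'b::real_normed_vector) \<Rightarrow> 'a set \<Rightarrow> bool" where
  "Ck_on 0 f S \<longleftrightarrow> continuous_on S f"
| "Ck_on (Suc k) f S \<longleftrightarrow>
     (\<forall>x\<in>S. f differentiable (at x)) \<and>
     (\<forall>v. Ck_on k (\<lambda>x. frechet_derivative f (at x) v) S)"

definition smooth_on :: "('a::euclidean_space \<Rightarrow> 'b::real_normed_vector) \<Rightarrow> 'a set \<Rightarrow> bool" where
  "smooth_on f S \<longleftrightarrow> (\<forall>k. Ck_on k f S)"

definition smooth_hypersurface :: "'a::euclidean_space set \<Rightarrow> bool" where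
  "smooth_hypersurface M \<longleftrightarrow>
     (\<forall>p\<in>M. \<exists>U (\<phi> :: 'a \<Rightarrow> real). open U \<and> p \<in> U \<and> smooth_on \<phi> U \<and>
        (\<forall>x\<in>M \<inter> U. \<exists>v. frechet_derivative \<phi> (at x) v \<noteq> 0) \<and>
        M \<inter> U = {x \<in> U. \<phi> x = 0})"

definition convex_body :: "'a::euclidean_space set \<Rightarrow> bool" where
  "convex_body K \<longleftrightarrow> compact K \<and> convex K \<and> interior K \<noteq> {}"

definition origin_symmetric :: "'a::real_vector set \<Rightarrow> bool" where
  "origin_symmetric K \<longleftrightarrow> uminus ` K = K"

definition minkowski :: "'a::real_vector set \<Rightarrow> 'a \<Rightarrow> real" where
  "minkowski K x = Inf {a. 0 < a \<and> x \<in> (\<lambda>y. a *\<^sub>R y) ` K}"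

definition radial :: "'a::real_vector set \<Rightarrow> 'a \<Rightarrow> real" where
  "radial K x = inverse (minkowski K x)"

definition star_body :: "'a::euclidean_space set \<Rightarrow> bool" where
  "star_body K \<longleftrightarrow> compact K \<and> 0 \<in> interior K \<and> (\<forall>x\<in>K. closed_segment 0 x \<subseteq> K)"

(* For star bodies the infimum is a minimum when x is not 0. *)
lemma minkowski_is_min:
  fixes K :: "'a::euclidean_space set"
  assumes K: "star_body K" and x: "x \<noteq> 0"
  shows "0 < minkowski K x \<and> x \<in> (\<lambda>y. minkowski K x *\<^sub>R y) ` K"
    and "\<And>a. \<lbrakk>0 < a; x \<in> (\<lambda>y. a *\<^sub>R y) ` K\<rbrakk> \<Longrightarrow> minkowski K x \<le> a"
proof -
  define A where "A = {a. 0 < a \<and> x \<in> (\<lambda>y. a *\<^sub>R y) ` K}"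
  have m: "minkowski K x = Inf A" by (simp add: minkowski_def A_def)
  have bd: "bdd_below A" unfolding A_def by (rule bdd_belowI[of _ 0]) auto
  have cK: "compact K" and iK: "0 \<in> interior K" using K by (auto simp: star_body_def)
  have A_iff: "a \<in> A \<longleftrightarrow> 0 < a \<and> inverse a *\<^sub>R x \<in> K" for a
    unfolding A_def by (force simp: image_iff)
  obtain e where e: "e > 0" "ball 0 e \<subseteq> K" using iK by (meson mem_interior)
  have "2 * norm x / e \<in> A"
    using e x by (auto simp: A_iff intro!: subsetD[OF e(2)])
  then have ne: "A \<noteq> {}" by auto
  obtain B where B: "B > 0" "\<And>y. y \<in> K \<Longrightarrow> norm y \<le> B"
    using compact_imp_bounded[OF cK] by (auto simp: bounded_pos)
  have "norm x / B \<le> a" if "a \<in> A" for a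
    using that B(2)[of "inverse a *\<^sub>R x"] B(1) by (auto simp: A_iff field_simps)
  then have "norm x / B \<le> Inf A" using ne by (intro cInf_greatest) auto
  then have pos: "0 < Inf A" using x B(1) by (meson divide_pos_pos less_le_trans zero_less_norm_iff)
  obtain s where s: "\<And>n. s n \<in> A" "s \<longlonglongrightarrow> Inf A"
    using closure_contains_Inf[OF ne bd] by (auto simp: closure_sequential)
  have "(\<lambda>n. inverse (s n) *\<^sub>R x) \<longlonglongrightarrow> inverse (Inf A) *\<^sub>R x"
    using s(2) pos by (intro tendsto_intros) auto
  then have "inverse (Inf A) *\<^sub>R x \<in> K"
  proof (rule closed_sequentially[OF compact_imp_closed[OF cK], rotated])
    show "inverse (s n) *\<^sub>R x \<in> K" for n using s(1) A_iff by blast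
  qed
  then have "Inf A \<in> A" using pos by (simp add: A_iff)
  then show "0 < minkowski K x \<and> x \<in> (\<lambda>y. minkowski K x *\<^sub>R y) ` K"
    unfolding m by (simp add: A_def)
  show "minkowski K x \<le> a" if "0 < a" "x \<in> (\<lambda>y. a *\<^sub>R y) ` K" for a
    unfolding m using that bd by (intro cInf_lower) (auto simp: A_def)
qed

(* Gauss map of a convex body: unique for every boundary point when the boundary is smooth. *)
definition outer_normal :: "'a::euclidean_space set \<Rightarrow> 'a \<Rightarrow> 'a" where
  "outer_normal K p = (THE u. norm u = 1 \<and> (\<forall>y\<in>K. u \<bullet> (y - p) \<le> 0))"

(* Determinant of the differential dN of the Gauss map N on the tangent space T at p, which is
   the orthogonal complement of N(p). The derivative of N within the boundary is only determined
   on T, so it is composed with the orthogonal projection onto T; it maps T to T. The identity on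
   the normal line is added to obtain an endomorphism of the whole space with the same
   determinant. With the outer normal, a sphere of radius r has curvature r^(1-n). *)
definition gauss_curvature :: "(real^'n) set \<Rightarrow> real^'n \<Rightarrow> real" where
  "gauss_curvature K p =
     (let N = outer_normal K;
          dN = frechet_derivative N (at p within frontier K)
      in det (matrix (\<lambda>v. dN (v - (v \<bullet> N p) *\<^sub>R N p) + (v \<bullet> N p) *\<^sub>R N p)))"

definition smooth_positive_curvature :: "(real^'n) set \<Rightarrow> bool" where
  "smooth_positive_curvature K \<longleftrightarrow>
     smooth_hypersurface (frontier K) \<and> (\<forall>p\<in>frontier K. 0 < gauss_curvature K p)"

definition perturbed_radial_eq ::
    "(real^'n \<Rightarrow> real) \<Rightarrow> (real^'n \<Rightarrow> real) \<Rightarrow> (real^'n) set \<Rightarrow> real \<Rightarrow> (real^'n) set \<Rightarrow> bool" where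
  "perturbed_radial_eq f g L \<epsilon> D \<longleftrightarrow> (\<forall>x\<in>sphere 0 1.
     (LBINT t:{0<..radial D x}. t ^ (CARD('n) - 2) * f (t *\<^sub>R x)) =
     (LBINT t:{0<..radial L x}. t ^ (CARD('n) - 2) * f (t *\<^sub>R x)) - \<epsilon> * g x)"

end

theory Submission
  imports Defs
begin

text \<open>Let \<open>m\<close> be the Minkowski functional of \<open>L\<close>. Since \<open>L\<close> is smooth, implicit differentiation shows
  that \<open>m\<close> is smooth off the origin, and the radial equation for \<open>D\<close> can be rewritten as
  \<open>D = {y. m y + \<epsilon> \<kappa> y \<le> 1}\<close> for a \<open>C\<^sup>2\<close> function \<open>\<kappa>\<close> that does not depend on \<open>\<epsilon>\<close>. If \<open>D\<close> is not convex,
  shrinking a chord towards the origin until it first fits into \<open>D\<close> gives a segment in \<open>D\<close> that touches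
  the boundary from inside at a relative interior point, so there the derivative of \<open>m + \<epsilon> \<kappa>\<close> along
  the chord vanishes and the second derivative is not positive. For \<open>m\<close> itself, positive curvature
  of \<open>L\<close> makes the second derivative positive in every direction in which the first one vanishes:
  the Hessian of \<open>m\<close> is symmetric and positive semidefinite, so a null direction would be
  in the kernel of the differential of the Gauss map. By compactness this survives a small \<open>C\<^sup>2\<close>
  perturbation.\<close>


section \<open>Functions of class \<open>C\<^sup>k\<close> on open sets\<close>

lemma Ck_on_cong:
  assumes "open S" "\<And>x. x \<in> S \<Longrightarrow> f x = g x" "Ck_on k f S"
  shows "Ck_on k g S"
  using assms(2,3)
proof (induction k arbitrary: f g)
  case 0
  then show ?case using continuous_on_cong by force
next
  case (Suc k)
  have g: "(g has_derivative frechet_derivative f (at x)) (at x)" if "x \<in> S" for x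
    by (rule has_derivative_transform_within_open[of f _ _ _ S])
      (use Suc.prems(2) that assms(1) Suc.prems(1) in \<open>auto simp: frechet_derivative_works\<close>)
  have "frechet_derivative f (at x) = frechet_derivative g (at x)" if "x \<in> S" for x
    using frechet_derivative_at[OF g[OF that]] .
  then have "Ck_on k (\<lambda>x. frechet_derivative g (at x) v) S" for v
    using Suc.prems(2) Suc.IH[of "\<lambda>x. frechet_derivative f (at x) v"] by auto
  then show ?case using g by (auto simp: differentiable_def)
qed

lemma Ck_onI_Suc:
  assumes "open S" "\<And>x. x \<in> S \<Longrightarrow> (f has_derivative f' x) (at x)"
    and "\<And>v. Ck_on k (\<lambda>x. f' x v) S"
  shows "Ck_on (Suc k) f S"
proof -
  have "f' x = frechet_derivative f (at x)" if "x \<in> S" for x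
    using frechet_derivative_at[OF assms(2)[OF that]] .
  then have "Ck_on k (\<lambda>x. frechet_derivative f (at x) v) S" for v
    using assms(3)[of v] by (auto intro: Ck_on_cong[OF assms(1), of "\<lambda>x. f' x v"])
  then show ?thesis using assms(2) by (auto simp: differentiable_def)
qed

lemma Ck_on_has_derivative:
  assumes "Ck_on k f S" "k > 0" "x \<in> S"
  shows "(f has_derivative frechet_derivative f (at x)) (at x)"
  using assms by (cases k) (auto simp: frechet_derivative_works)

lemma Ck_on_subset:
  assumes "Ck_on k f S" "T \<subseteq> S"
  shows "Ck_on k f T"
  using assms by (induction k arbitrary: f) (auto intro: continuous_on_subset)

lemma Ck_on_local:
  assumes "\<And>x. x \<in> S \<Longrightarrow> \<exists>U. open U \<and> x \<in> U \<and> Ck_on k f U"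
  shows "Ck_on k f S"
  using assms
proof (induction k arbitrary: f)
  case 0
  have "isCont f x" if "x \<in> S" for x
    using 0[OF that] by (auto simp: continuous_on_eq_continuous_at)
  then show ?case by (simp add: continuous_at_imp_continuous_on)
next
  case (Suc k)
  show ?case
    using Suc.prems by (fastforce intro!: Suc.IH)
qed

lemma Ck_on_imp_continuous_on: "Ck_on k f S \<Longrightarrow> continuous_on S f"
  by (cases k) (auto intro!: continuous_at_imp_continuous_on differentiable_imp_continuous_within)

lemma Ck_on_SucD: "Ck_on (Suc k) f S \<Longrightarrow> Ck_on k f S"
proof (induction k arbitrary: f)
  case 0
  then show ?case using Ck_on_imp_continuous_on by fastforce
next
  case (Suc k)
  then show ?case by (metis Ck_on.simps(2))
qed

lemma Ck_on_const: "Ck_on k (\<lambda>x. c) S"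
  by (induction k arbitrary: c) auto

lemma Ck_on_linear:
  assumes "bounded_linear F" "open S"
  shows "Ck_on k F S"
proof (cases k)
  case (Suc n)
  have "Ck_on (Suc n) F S"
    by (rule Ck_onI_Suc[where f'="\<lambda>_. F"])
      (use assms in \<open>auto intro: bounded_linear_imp_has_derivative Ck_on_const\<close>)
  then show ?thesis using Suc by simp
qed (use assms in \<open>auto intro: linear_continuous_on\<close>)

lemma Ck_on_bounded_linear:
  assumes "bounded_linear F" "open S" "Ck_on k f S"
  shows "Ck_on k (\<lambda>x. F (f x)) S"
  using assms(3)
proof (induction k arbitrary: f)
  case 0
  then show ?case
    using bounded_linear.continuous_on[OF assms(1)] by auto
next
  case (Suc k)
  show ?case
  proof (rule Ck_onI_Suc[OF assms(2)])
    show "((\<lambda>x. F (f x)) has_derivative (\<lambda>v. F (frechet_derivative f (at x) v))) (at x)" if "x \<in> S" for x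
      using Ck_on_has_derivative[OF Suc.prems _ that] bounded_linear.has_derivative[OF assms(1)] by blast
    show "Ck_on k (\<lambda>x. F (frechet_derivative f (at x) v)) S" for v
      using Suc by auto
  qed
qed

lemma Ck_on_add:
  assumes "open S" "Ck_on k f S" "Ck_on k g S"
  shows "Ck_on k (\<lambda>x. f x + g x) S"
  using assms(2,3)
proof (induction k arbitrary: f g)
  case 0
  then show ?case by (auto intro: continuous_intros)
next
  case (Suc k)
  show ?case
  proof (rule Ck_onI_Suc[OF assms(1)])
    show "((\<lambda>x. f x + g x) has_derivative (\<lambda>v. frechet_derivative f (at x) v + frechet_derivative g (at x) v)) (at x)" 
      if "x \<in> S" for x
      using Ck_on_has_derivative[OF Suc.prems(1) _ that] Ck_on_has_derivative[OF Suc.prems(2) _ that]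
      by (auto intro!: derivative_eq_intros)
    show "Ck_on k (\<lambda>x. frechet_derivative f (at x) v + frechet_derivative g (at x) v) S" for v
      using Suc by auto
  qed
qed

lemma Ck_on_scaleR:
  assumes "open S" "Ck_on k f S" "Ck_on k g S"
  shows "Ck_on k (\<lambda>x. f x *\<^sub>R g x) S"
  using assms(2,3)
proof (induction k arbitrary: f g)
  case 0
  then show ?case by (auto intro: continuous_intros)
next
  case (Suc k)
  show ?case
  proof (rule Ck_onI_Suc[OF assms(1)])
    show "((\<lambda>x. f x *\<^sub>R g x) has_derivative
        (\<lambda>v. f x *\<^sub>R frechet_derivative g (at x) v + frechet_derivative f (at x) v *\<^sub>R g x)) (at x)"
      if "x \<in> S" for x
      using Ck_on_has_derivative[OF Suc.prems(1) _ that] Ck_on_has_derivative[OF Suc.prems(2) _ that]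
      by (auto intro!: derivative_eq_intros)
    show "Ck_on k (\<lambda>x. f x *\<^sub>R frechet_derivative g (at x) v + frechet_derivative f (at x) v *\<^sub>R g x) S" for v
      using Suc Ck_on_SucD[OF Suc.prems(1)] Ck_on_SucD[OF Suc.prems(2)]
      by (intro Ck_on_add[OF assms(1)]) auto
  qed
qed

lemma Ck_on_mult:
  fixes f g :: "'a::euclidean_space \<Rightarrow> real"
  shows "\<lbrakk>open S; Ck_on k f S; Ck_on k g S\<rbrakk> \<Longrightarrow> Ck_on k (\<lambda>x. f x * g x) S"
  using Ck_on_scaleR[of S k f g] by simp

lemma Ck_on_power:
  fixes f :: "'a::euclidean_space \<Rightarrow> real"
  assumes "open S" "Ck_on k f S"
  shows "Ck_on k (\<lambda>x. f x ^ j) S"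
  by (induction j) (auto intro: Ck_on_const Ck_on_mult assms)

lemma Ck_on_uminus:
  assumes "open S" "Ck_on k f S"
  shows "Ck_on k (\<lambda>x. - f x) S"
  using Ck_on_bounded_linear[OF bounded_linear_minus[OF bounded_linear_ident] assms] .

lemma Ck_on_diff:
  assumes "open S" "Ck_on k f S" "Ck_on k g S"
  shows "Ck_on k (\<lambda>x. f x - g x) S"
  using Ck_on_add[OF assms(1,2) Ck_on_uminus[OF assms(1,3)]] by simp

lemma Ck_on_sum:
  assumes "open S" "\<And>i. i \<in> I \<Longrightarrow> Ck_on k (f i) S"
  shows "Ck_on k (\<lambda>x. \<Sum>i\<in>I. f i x) S"
proof (cases "finite I")
  case True
  then show ?thesis using assms(2)
    by (induction I) (auto intro: Ck_on_const Ck_on_add assms(1))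
qed (auto intro: Ck_on_const)

lemma Ck_on_inverse:
  fixes f :: "'a::euclidean_space \<Rightarrow> real"
  assumes "open S" "Ck_on k f S" "\<And>x. x \<in> S \<Longrightarrow> f x \<noteq> 0"
  shows "Ck_on k (\<lambda>x. inverse (f x)) S"
  using assms(2)
proof (induction k)
  case 0
  then show ?case using assms(3) by (auto intro: continuous_intros)
next
  case (Suc k)
  show ?case
  proof (rule Ck_onI_Suc[OF assms(1)])
    show "((\<lambda>x. inverse (f x)) has_derivative
        (\<lambda>v. - (inverse (f x) * frechet_derivative f (at x) v * inverse (f x)))) (at x)"
      if "x \<in> S" for x
      using Ck_on_has_derivative[OF Suc.prems(1) _ that] assms(3)[OF that]
      by (auto intro!: derivative_eq_intros)
    show "Ck_on k (\<lambda>x. - (inverse (f x) * frechet_derivative f (at x) v * inverse (f x))) S" for v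
      using Suc Ck_on_SucD[OF Suc.prems(1)]
      by (intro Ck_on_uminus Ck_on_mult assms(1)) auto
  qed
qed

lemma Ck_on_divide:
  fixes f :: "'a::euclidean_space \<Rightarrow> real"
  assumes "open S" "Ck_on k f S" "Ck_on k g S" "\<And>x. x \<in> S \<Longrightarrow> g x \<noteq> 0"
  shows "Ck_on k (\<lambda>x. f x / g x) S"
  using Ck_on_mult[OF assms(1,2) Ck_on_inverse[OF assms(1,3,4)]] by (simp add: divide_inverse)

lemma Ck_on_norm: "Ck_on k norm (- {0::'a::euclidean_space})"
proof (induction k)
  case 0
  then show ?case by (auto intro: continuous_intros)
next
  case (Suc k)
  have o: "open (- {0::'a})" by auto
  show ?case
  proof (rule Ck_onI_Suc[OF o])
    show "(norm has_derivative (\<lambda>v. (x \<bullet> v) / norm x)) (at x)" if "x \<in> - {0::'a}" for x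
      using that has_derivative_norm[of x]
      by (auto simp: sgn_div_norm divide_inverse mult.commute inner_commute)
    show "Ck_on k (\<lambda>x. (x \<bullet> v) / norm x) (- {0})" for v :: 'a
      by (rule Ck_on_divide[OF o Ck_on_linear[OF bounded_linear_inner_left o] Suc]) auto
  qed
qed

lemma Ck_on_compose:
  fixes G :: "'a::euclidean_space \<Rightarrow> 'b::euclidean_space" and f :: "'b \<Rightarrow> 'c::real_normed_vector"
  assumes "open S" "Ck_on k f T" "Ck_on k G S" "\<And>x. x \<in> S \<Longrightarrow> G x \<in> T"
  shows "Ck_on k (\<lambda>x. f (G x)) S"
  using assms(2,3)
proof (induction k arbitrary: f)
  case 0
  then show ?case using assms(4) by (auto intro: continuous_on_compose2)
next
  case (Suc k)
  show ?case
  proof (rule Ck_onI_Suc[OF assms(1)])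
    fix x assume x: "x \<in> S"
    have f: "(f has_derivative frechet_derivative f (at (G x))) (at (G x))"
      using Ck_on_has_derivative[OF Suc.prems(1)] assms(4)[OF x] by auto
    interpret bounded_linear "frechet_derivative f (at (G x))"
      using f by (rule has_derivative_bounded_linear)
    have "((\<lambda>x. f (G x)) has_derivative (\<lambda>v. frechet_derivative f (at (G x)) (frechet_derivative G (at x) v))) (at x)"
      using has_derivative_compose[where f=G, OF Ck_on_has_derivative[OF Suc.prems(2) _ x] f] by simp
    moreover have "frechet_derivative f (at (G x)) (frechet_derivative G (at x) v) =
      (\<Sum>b\<in>Basis. (frechet_derivative G (at x) v \<bullet> b) *\<^sub>R frechet_derivative f (at (G x)) b)" for v
    proof -
      have "frechet_derivative f (at (G x)) (frechet_derivative G (at x) v) = 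
        frechet_derivative f (at (G x)) (\<Sum>b\<in>Basis. (frechet_derivative G (at x) v \<bullet> b) *\<^sub>R b)"
        by (simp add: euclidean_representation)
      then show ?thesis by (simp add: sum scale)
    qed
    ultimately show "((\<lambda>x. f (G x)) has_derivative (\<lambda>v. \<Sum>b\<in>Basis. (frechet_derivative G (at x) v \<bullet> b) *\<^sub>R frechet_derivative f (at (G x)) b)) (at x)"
      by simp
  next
    show "Ck_on k (\<lambda>x. \<Sum>b\<in>Basis. (frechet_derivative G (at x) v \<bullet> b) *\<^sub>R frechet_derivative f (at (G x)) b) S" for v
      using Suc.prems Ck_on_SucD[OF Suc.prems(2)]
      by (intro Ck_on_sum Ck_on_scaleR assms(1) Ck_on_bounded_linear[OF bounded_linear_inner_left] Suc.IH) auto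
  qed
qed

lemma Ck_on_integral:
  fixes a :: "'a::euclidean_space \<times> real \<Rightarrow> real"
  assumes "open U" "open S" "U \<times> {0..1} \<subseteq> S" "Ck_on k a S"
  shows "Ck_on k (\<lambda>y. integral {0..1} (\<lambda>t. a (y, t))) U"
  using assms(4)
proof (induction k arbitrary: a)
  case 0
  have "continuous_on (U \<times> {0..1}) a" using 0 assms(3) continuous_on_subset by auto
  then show ?case
    using integral_continuous_on_param[of U 0 1 "\<lambda>y t. a (y, t)"]
    by (simp add: case_prod_unfold)
next
  case (Suc k)
  let ?D = "\<lambda>y t v. frechet_derivative a (at (y, t)) (v, 0)"
  show ?case
  proof (rule Ck_onI_Suc[OF assms(1)])
    fix x assume "x \<in> U"
    then obtain e where e: "e > 0" "ball x e \<subseteq> U"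
      using assms(1) openE by blast
    let ?B = "ball x e"
    have a: "(a has_derivative frechet_derivative a (at (y, t))) (at (y, t))" if "y \<in> U" "t \<in> {0..1}" for y t
      by (rule Ck_on_has_derivative[OF Suc.prems]) (use assms(3) that in auto)
    have pd: "((\<lambda>y. a (y, t)) has_derivative ?D y t) (at y)" if "y \<in> U" "t \<in> {0..1}" for y t
      by (rule has_derivative_compose[where f="\<lambda>y. (y, t)" and f'="\<lambda>v. (v, 0)" and g=a, OF _ a[OF that]])
        (auto intro!: derivative_eq_intros)
    then have bl: "bounded_linear (?D y t)" if "y \<in> U" "t \<in> {0..1}" for y t
      using that has_derivative_bounded_linear by blast
    have cD: "continuous_on (U \<times> {0..1}) (\<lambda>(y, t). ?D y t v)" for v
    proof -
      have "continuous_on S (\<lambda>z. frechet_derivative a (at z) (v, 0))"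
        by (rule Ck_on_imp_continuous_on[of k]) (use Suc.prems in auto)
      then show ?thesis using assms(3) continuous_on_subset by (auto simp: case_prod_unfold)
    qed
    have ca: "continuous_on (U \<times> {0..1}) a"
      using Ck_on_imp_continuous_on[OF Suc.prems] assms(3) continuous_on_subset by auto
    have ca1: "continuous_on {0..1} (\<lambda>t. a (y, t))" if "y \<in> U" for y
      by (rule continuous_on_compose2[OF ca]) (use that in \<open>auto intro!: continuous_intros\<close>)
    let ?F = "\<lambda>y t. Blinfun (?D y t)"
    have F: "blinfun_apply (?F y t) = ?D y t" if "y \<in> U" "t \<in> {0..1}" for y t
      using bl[OF that] by (rule bounded_linear_Blinfun_apply)
    have cF: "continuous_on (U \<times> cbox 0 1) (\<lambda>(y, t). ?F y t)"
    proof (rule continuous_on_blinfun_componentwise)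
      fix i :: 'a
      show "continuous_on (U \<times> cbox 0 1) (\<lambda>z. blinfun_apply (case z of (y, t) \<Rightarrow> ?F y t) i)"
        unfolding cbox_interval by (rule continuous_on_eq[OF cD[of i]]) (auto simp: F)
    qed
    have "((\<lambda>y. integral (cbox 0 1) (\<lambda>t. a (y, t))) has_derivative integral (cbox 0 1) (?F x)) (at x within ?B)"
    proof (rule leibniz_rule)
      fix y t assume *: "y \<in> ?B" "t \<in> cbox (0::real) 1"
      then have yt: "y \<in> U" "t \<in> {0..1}" using e by auto
      show "((\<lambda>x. a (x, t)) has_derivative blinfun_apply (?F y t)) (at y within ?B)"
        unfolding F[OF yt] using pd[OF yt] has_derivative_at_withinI by blast
    next
      fix y assume "y \<in> ?B"
      then have "y \<in> U" using e by auto
      then show "(\<lambda>t. a (y, t)) integrable_on cbox 0 1"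
        using ca1 integrable_continuous_interval by auto
    next
      show "continuous_on (?B \<times> cbox 0 1) (\<lambda>(y, t). ?F y t)"
        by (rule continuous_on_subset[OF cF]) (use e in auto)
    qed (use e in auto)
    moreover have "blinfun_apply (integral (cbox 0 1) (?F x)) v = integral {0..1} (\<lambda>t. ?D x t v)" for v
    proof -
      have "?F x integrable_on cbox 0 1"
        by (rule integrable_continuous, rule continuous_on_compose2[OF cF, of _ "\<lambda>t. (x, t)", simplified])
          (use \<open>x \<in> U\<close> in \<open>auto intro!: continuous_intros\<close>)
      then have "blinfun_apply (integral (cbox 0 1) (?F x)) v = integral (cbox 0 1) (\<lambda>t. blinfun_apply (?F x t) v)"
        by (rule blinfun_apply_integral)
      also have "\<dots> = integral {0..1} (\<lambda>t. ?D x t v)"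
        unfolding cbox_interval by (rule integral_cong) (use F \<open>x \<in> U\<close> in auto)
      finally show ?thesis .
    qed
    then have "blinfun_apply (integral (cbox 0 1) (?F x)) = (\<lambda>v. integral {0..1} (\<lambda>t. ?D x t v))" ..
    ultimately show "((\<lambda>y. integral {0..1} (\<lambda>t. a (y, t))) has_derivative
        (\<lambda>v. integral {0..1} (\<lambda>t. ?D x t v))) (at x)"
      using e at_within_open[of x ?B] by simp
  next
    show "Ck_on k (\<lambda>y. integral {0..1} (\<lambda>t. ?D y t v)) U" for v
      using Suc.prems by (intro Suc.IH) auto
  qed
qed

section \<open>Directional derivatives of second order\<close>

definition dderiv :: "('a::euclidean_space \<Rightarrow> real) \<Rightarrow> 'a \<Rightarrow> 'a \<Rightarrow> real" where
  "dderiv f v x = frechet_derivative f (at x) v"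

lemma Ck_on_dderiv: "Ck_on (Suc k) f S \<Longrightarrow> Ck_on k (dderiv f v) S"
  by (simp add: dderiv_def[abs_def])

lemma dderiv_eqI: "(f has_derivative f') (at x) \<Longrightarrow> dderiv f v x = f' v"
  unfolding dderiv_def using frechet_derivative_at by metis

lemma has_derivative_dderiv:
  assumes "Ck_on (Suc k) f S" "x \<in> S"
  shows "(f has_derivative (\<lambda>v. dderiv f v x)) (at x)"
  using Ck_on_has_derivative[OF assms(1) _ assms(2)] by (simp add: dderiv_def)

lemma linear_dderiv:
  assumes "Ck_on (Suc k) f S" "x \<in> S"
  shows "linear (\<lambda>v. dderiv f v x)"
  using has_derivative_linear[OF has_derivative_dderiv[OF assms]] .

lemma dderiv_line:
  assumes "Ck_on (Suc k) f S" "x + r *\<^sub>R v \<in> S"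
  shows "((\<lambda>r. f (x + r *\<^sub>R v)) has_real_derivative dderiv f v (x + r *\<^sub>R v)) (at r)"
proof -
  have "((\<lambda>r. f (x + r *\<^sub>R v)) has_derivative (\<lambda>h. dderiv f (h *\<^sub>R v) (x + r *\<^sub>R v))) (at r)"
    by (rule has_derivative_compose[where f="\<lambda>r. x + r *\<^sub>R v" and g=f, OF _ has_derivative_dderiv[OF assms]])
      (auto intro!: derivative_eq_intros)
  then show ?thesis
    using linear_cmul[OF linear_dderiv[OF assms]]
    by (simp add: has_field_derivative_def mult_commute_abs)
qed

lemma second_difference:
  assumes "Ck_on 2 f S" "h > 0"
    and S: "\<And>s t. \<lbrakk>0 \<le> s; s \<le> h; 0 \<le> t; t \<le> h\<rbrakk> \<Longrightarrow> x + s *\<^sub>R v + t *\<^sub>R w \<in> S"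
  obtains s t where "0 \<le> s" "s \<le> h" "0 \<le> t" "t \<le> h"
    and "f (x + h *\<^sub>R v + h *\<^sub>R w) - f (x + h *\<^sub>R v) - f (x + h *\<^sub>R w) + f x
       = h\<^sup>2 * dderiv (dderiv f v) w (x + s *\<^sub>R v + t *\<^sub>R w)"
proof -
  have C: "Ck_on (Suc 1) f S" using assms(1) by (simp add: numeral_2_eq_2)
  have C1: "Ck_on (Suc 0) (dderiv f v) S" using Ck_on_dderiv[OF C] by simp
  define g where "g s = f ((x + h *\<^sub>R w) + s *\<^sub>R v) - f (x + s *\<^sub>R v)" for s
  have g: "(g has_real_derivative dderiv f v ((x + h *\<^sub>R w) + s *\<^sub>R v) - dderiv f v (x + s *\<^sub>R v)) (at s)"
    if "0 \<le> s" "s \<le> h" for s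
    unfolding g_def
    by (intro derivative_intros dderiv_line[OF C]) (use S[of s h] S[of s 0] that assms(2) in \<open>auto simp: algebra_simps\<close>)
  obtain s where s: "0 < s" "s < h"
    "g h - g 0 = (h - 0) * (dderiv f v ((x + h *\<^sub>R w) + s *\<^sub>R v) - dderiv f v (x + s *\<^sub>R v))"
    using MVT2[OF assms(2) g] by auto
  have k: "((\<lambda>t. dderiv f v ((x + s *\<^sub>R v) + t *\<^sub>R w)) has_real_derivative
      dderiv (dderiv f v) w ((x + s *\<^sub>R v) + t *\<^sub>R w)) (at t)" if "0 \<le> t" "t \<le> h" for t
    by (rule dderiv_line[OF C1]) (use S[of s t] that s in auto)
  obtain t where t: "0 < t" "t < h"
    "dderiv f v ((x + s *\<^sub>R v) + h *\<^sub>R w) - dderiv f v ((x + s *\<^sub>R v) + 0 *\<^sub>R w)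
      = (h - 0) * dderiv (dderiv f v) w ((x + s *\<^sub>R v) + t *\<^sub>R w)"
    using MVT2[OF assms(2) k] by auto
  have "g h - g 0 = h\<^sup>2 * dderiv (dderiv f v) w (x + s *\<^sub>R v + t *\<^sub>R w)"
    using s(3) t(3) by (simp add: algebra_simps power2_eq_square)
  then show ?thesis
    using that[of s t] s t by (simp add: g_def algebra_simps)
qed

lemma dderiv_commute:
  assumes "open S" "Ck_on 2 f S" "x \<in> S"
  shows "dderiv (dderiv f v) w x = dderiv (dderiv f w) v x"
proof -
  obtain e where e: "e > 0" "ball x e \<subseteq> S" using assms openE by blast
  define M where "M = norm v + norm w + 1"
  define h where "h n = e / (2 * M) * inverse (real (Suc n))" for n
  have M: "M > 0" by (simp add: M_def add_nonneg_pos)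
  have h: "h n > 0" "h n * M < e" for n
  proof -
    show "h n > 0" using e M by (simp add: h_def)
    have "h n * M = e / 2 * inverse (real (Suc n))" using M by (simp add: h_def)
    also have "\<dots> \<le> e / 2 * 1" using e by (intro mult_left_mono) (auto simp: field_simps)
    finally show "h n * M < e" using e by simp
  qed
  have near: "norm (s *\<^sub>R a + t *\<^sub>R b) \<le> h n * M" 
    if "0 \<le> s" "s \<le> h n" "0 \<le> t" "t \<le> h n" "norm a + norm b + 1 = M" for s t n and a b :: 'a
  proof -
    have "norm (s *\<^sub>R a + t *\<^sub>R b) \<le> s * norm a + t * norm b"
      using norm_triangle_ineq[of "s *\<^sub>R a" "t *\<^sub>R b"] that by simp
    also have "\<dots> \<le> h n * norm a + h n * norm b"
      using that by (intro add_mono mult_right_mono) auto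
    also have "\<dots> \<le> h n * M" using h(1)[of n] that(5) by (auto simp: algebra_simps simp flip: that(5))
    finally show ?thesis .
  qed
  have inS: "x + s *\<^sub>R a + t *\<^sub>R b \<in> S" 
    if "0 \<le> s" "s \<le> h n" "0 \<le> t" "t \<le> h n" "norm a + norm b + 1 = M" for s t n and a b :: 'a
  proof -
    have "dist x (x + s *\<^sub>R a + t *\<^sub>R b) = norm (s *\<^sub>R a + t *\<^sub>R b)"
      by (subst dist_commute) (simp add: dist_norm add.assoc)
    then show ?thesis using near[OF that] h(2)[of n] e(2) by (auto intro!: subsetD[OF e(2)])
  qed
  have hM: "(\<lambda>n. h n * M) \<longlonglongrightarrow> 0"
  proof -
    have "(\<lambda>n. (e / 2) * inverse (real (Suc n))) \<longlonglongrightarrow> 0"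
      by (intro tendsto_mult_right_zero LIMSEQ_inverse_real_of_nat)
    then show ?thesis using M by (simp add: h_def)
  qed
  have lim: "\<exists>p. (\<forall>n. f (x + h n *\<^sub>R a + h n *\<^sub>R b) - f (x + h n *\<^sub>R a) - f (x + h n *\<^sub>R b) + f x
       = (h n)\<^sup>2 * p n) \<and> p \<longlonglongrightarrow> dderiv (dderiv f a) b x" if ab: "norm a + norm b + 1 = M" for a b :: 'a
  proof -
    have "\<exists>p. f (x + h n *\<^sub>R a + h n *\<^sub>R b) - f (x + h n *\<^sub>R a) - f (x + h n *\<^sub>R b) + f x
       = (h n)\<^sup>2 * dderiv (dderiv f a) b p \<and> norm (p - x) \<le> h n * M \<and> p \<in> S" for n
    proof -
      obtain s t where st: "0 \<le> s" "s \<le> h n" "0 \<le> t" "t \<le> h n"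
       "f (x + h n *\<^sub>R a + h n *\<^sub>R b) - f (x + h n *\<^sub>R a) - f (x + h n *\<^sub>R b) + f x
         = (h n)\<^sup>2 * dderiv (dderiv f a) b (x + s *\<^sub>R a + t *\<^sub>R b)"
        using second_difference[OF assms(2) h(1)[of n], of x a b] inS ab by metis
      then show ?thesis
        using near[OF st(1-4) ab] inS[OF st(1-4) ab]
        by (intro exI[of _ "x + s *\<^sub>R a + t *\<^sub>R b"]) (auto simp: add.assoc)
    qed
    then obtain p where p: "\<And>n. f (x + h n *\<^sub>R a + h n *\<^sub>R b) - f (x + h n *\<^sub>R a) - f (x + h n *\<^sub>R b) + f x
       = (h n)\<^sup>2 * dderiv (dderiv f a) b (p n)" "\<And>n. norm (p n - x) \<le> h n * M" by metis
    have "(\<lambda>n. p n - x) \<longlonglongrightarrow> 0"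
      by (rule Lim_null_comparison[OF _ hM]) (use p in auto)
    then have px: "p \<longlonglongrightarrow> x" by (simp add: LIM_zero_iff)
    have "Ck_on 0 (dderiv (dderiv f a) b) S"
      using assms(2) by (intro Ck_on_dderiv) (simp add: numeral_2_eq_2)
    then have "isCont (dderiv (dderiv f a) b) x"
      using assms(1,3) by (simp add: continuous_on_eq_continuous_at)
    then have "(\<lambda>n. dderiv (dderiv f a) b (p n)) \<longlonglongrightarrow> dderiv (dderiv f a) b x"
      using px by (rule isCont_tendsto_compose)
    then show ?thesis using p(1) by (intro exI[of _ "\<lambda>n. dderiv (dderiv f a) b (p n)"]) auto
  qed
  obtain p where p: "\<And>n. f (x + h n *\<^sub>R v + h n *\<^sub>R w) - f (x + h n *\<^sub>R v) - f (x + h n *\<^sub>R w) + f x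
       = (h n)\<^sup>2 * p n" "p \<longlonglongrightarrow> dderiv (dderiv f v) w x" using lim[of v w] by (auto simp: M_def)
  obtain q where q: "\<And>n. f (x + h n *\<^sub>R w + h n *\<^sub>R v) - f (x + h n *\<^sub>R w) - f (x + h n *\<^sub>R v) + f x
       = (h n)\<^sup>2 * q n" "q \<longlonglongrightarrow> dderiv (dderiv f w) v x" using lim[of w v] by (auto simp: M_def)
  have "p n = q n" for n
  proof -
    have "(h n)\<^sup>2 * p n = (h n)\<^sup>2 * q n"
      unfolding p(1)[symmetric] q(1)[symmetric] by (simp add: algebra_simps)
    then show ?thesis using h(1)[of n] by simp
  qed
  then have "p = q" by auto
  then show ?thesis using p(2) q(2) LIMSEQ_unique by blast
qed

lemma linear_dderiv2:
  assumes "open S" "Ck_on 2 f S" "x \<in> S"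
  shows "linear (\<lambda>v. dderiv (dderiv f v) w x)" "linear (\<lambda>w. dderiv (dderiv f v) w x)"
proof -
  have "Ck_on (Suc 0) (dderiv f v) S" for v
    using assms(2) by (intro Ck_on_dderiv) (simp add: numeral_2_eq_2)
  then show l: "linear (\<lambda>w. dderiv (dderiv f v) w x)" for v
    using linear_dderiv assms(3) by blast
  show "linear (\<lambda>v. dderiv (dderiv f v) w x)"
    using l[of w] dderiv_commute[OF assms] by simp
qed

lemma linear_Basis_expansion:
  fixes F :: "'a::euclidean_space \<Rightarrow> real"
  assumes "linear F"
  shows "F v = (\<Sum>b\<in>Basis. (v \<bullet> b) * F b)"
proof -
  have "F v = F (\<Sum>b\<in>Basis. (v \<bullet> b) *\<^sub>R b)" by (simp add: euclidean_representation)
  then show ?thesis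
    using assms by (simp add: linear_sum linear_cmul)
qed

lemma continuous_on_dderiv_pair:
  assumes "Ck_on (Suc k) f S"
  shows "continuous_on (S \<times> UNIV) (\<lambda>z. dderiv f (snd z) (fst z))"
proof -
  have c: "continuous_on S (dderiv f b)" for b
    using Ck_on_imp_continuous_on[OF Ck_on_dderiv[OF assms]] .
  have "continuous_on (S \<times> UNIV) (\<lambda>z. \<Sum>b\<in>Basis. (snd z \<bullet> b) * dderiv f b (fst z))"
    by (intro continuous_intros continuous_on_compose2[OF c]) auto
  then show ?thesis
    by (rule continuous_on_eq) (auto simp: linear_Basis_expansion[OF linear_dderiv[OF assms], symmetric])
qed

lemma continuous_on_dderiv2_pair:
  assumes "open S" "Ck_on 2 f S"
  shows "continuous_on (S \<times> UNIV) (\<lambda>z. dderiv (dderiv f (snd z)) (snd z) (fst z))"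
proof -
  have "Ck_on (Suc 0) (dderiv f b) S" for b
    using assms(2) by (intro Ck_on_dderiv) (simp add: numeral_2_eq_2)
  note c = continuous_on_dderiv_pair[OF this]
  have "continuous_on (S \<times> UNIV) (\<lambda>z. \<Sum>b\<in>Basis. (snd z \<bullet> b) * dderiv (dderiv f b) (snd z) (fst z))"
    by (intro continuous_intros c)
  then show ?thesis
    by (rule continuous_on_eq)
      (auto simp: linear_Basis_expansion[OF linear_dderiv2(1)[OF assms], symmetric])
qed

lemma dderiv_local_max_on_line:
  assumes "Ck_on 2 f S" "open S" "q \<in> S" "d > 0"
    and max: "\<And>r. \<bar>r\<bar> < d \<Longrightarrow> f (q + r *\<^sub>R v) \<le> f q"
  shows "dderiv f v q = 0" "dderiv (dderiv f v) v q \<le> 0"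
proof -
  have C: "Ck_on (Suc 1) f S" using assms(1) by (simp add: numeral_2_eq_2)
  have C1: "Ck_on (Suc 0) (dderiv f v) S" using Ck_on_dderiv[OF C] by simp
  note D = dderiv_line[OF C, of q 0 v, simplified, OF assms(3)]
  show 0: "dderiv f v q = 0"
    by (rule DERIV_local_max[OF D assms(4)]) (use max in auto)
  note D2 = dderiv_line[OF C1, of q 0 v, simplified, OF assms(3)]
  show "dderiv (dderiv f v) v q \<le> 0"
  proof (rule ccontr)
    assume "\<not> ?thesis"
    then have "dderiv (dderiv f v) v q > 0" by simp
    from DERIV_pos_inc_right[OF D2 this] obtain e where e: "e > 0"
      "\<And>h. \<lbrakk>0 < h; h < e\<rbrakk> \<Longrightarrow> dderiv f v (q + h *\<^sub>R v) > 0" using 0 by auto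
    obtain e' where e': "e' > 0" "ball q e' \<subseteq> S" using assms(2,3) openE by blast
    define c where "c = e' / (norm v + 1)"
    have nv: "norm v + 1 > 0" by (simp add: add_nonneg_pos)
    have c: "c > 0" using e'(1) nv by (simp add: c_def)
    have inS: "q + r *\<^sub>R v \<in> S" if "\<bar>r\<bar> < c" for r
    proof -
      have "\<bar>r\<bar> * norm v \<le> \<bar>r\<bar> * (norm v + 1)" by (simp add: mult_left_mono)
      also have "\<dots> < e'" using that nv by (simp add: c_def field_simps)
      finally show ?thesis by (intro subsetD[OF e'(2)]) (simp add: dist_norm)
    qed
    define h where "h = min (min e c) d / 2"
    have h: "0 < h" "h < e" "h < c" "h < d" using e c assms(4) by (auto simp: h_def)
    have "((\<lambda>r. f (q + r *\<^sub>R v)) has_real_derivative dderiv f v (q + r *\<^sub>R v)) (at r)"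
      if "0 \<le> r" "r \<le> h" for r
      by (rule dderiv_line[OF C inS]) (use that h in auto)
    from MVT2[OF h(1) this] obtain s where s: "0 < s" "s < h" "f (q + h *\<^sub>R v) - f q = h * dderiv f v (q + s *\<^sub>R v)"
      by auto
    have "h * dderiv f v (q + s *\<^sub>R v) > 0" using e(2)[of s] s h by simp
    then show False using s(3) max[of h] h by simp
  qed
qed

lemma psd_form_null_vector:
  fixes B :: "'a::real_vector \<Rightarrow> 'a \<Rightarrow> real"
  assumes "\<And>v. linear (B v)" "\<And>v w. B v w = B w v" "\<And>v. B v v \<ge> 0" "B v v = 0"
  shows "B v w = 0"
proof -
  let ?b = "B v w" and ?c = "B w w"
  define t where "t = - ?b / (?c + 1)"
  have "(\<lambda>v. B v w) = B w" for w using assms(2) by blast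
  then have l: "linear (\<lambda>v. B v w)" for w using assms(1)[of w] by simp
  have "B (v + t *\<^sub>R w) (v + t *\<^sub>R w) = 2 * t * ?b + t\<^sup>2 * ?c"
    using assms(4) assms(2)[of w v]
    by (simp add: linear_add[OF assms(1)] linear_add[OF l] linear_cmul[OF assms(1)] linear_cmul[OF l] power2_eq_square algebra_simps)
  then have *: "0 \<le> 2 * t * ?b + t\<^sup>2 * ?c" using assms(3) by metis
  have c: "?c + 1 > 0" using assms(3)[of w] by simp
  have "?b = - t * (?c + 1)" using c by (simp add: t_def)
  then have "2 * t * ?b + t\<^sup>2 * ?c = 2 * t * (- t * (?c + 1)) + t\<^sup>2 * ?c" by simp
  also have "\<dots> = - (t\<^sup>2 * (?c + 2))" by (simp add: power2_eq_square algebra_simps)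
  finally have "0 \<le> - (t\<^sup>2 * (?c + 2))" using * by simp
  moreover have "t\<^sup>2 * (?c + 2) \<ge> 0" using c by simp
  ultimately have "t\<^sup>2 * (?c + 2) = 0" by linarith
  then have "t = 0" using c by simp
  then show ?thesis using c by (simp add: t_def)
qed

section \<open>Minkowski functionals\<close>

lemma minkowski_le_iff:
  fixes K :: "'a::euclidean_space set"
  assumes K: "star_body K" and x: "x \<noteq> 0" and a: "a > 0"
  shows "minkowski K x \<le> a \<longleftrightarrow> inverse a *\<^sub>R x \<in> K"
proof
  assume *: "inverse a *\<^sub>R x \<in> K"
  have "x \<in> (\<lambda>y. a *\<^sub>R y) ` K" by (rule image_eqI[OF _ *]) (use a in simp)
  then show "minkowski K x \<le> a" using minkowski_is_min(2)[OF K x a] by simp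
next
  assume le: "minkowski K x \<le> a"
  let ?m = "minkowski K x"
  obtain y where y: "0 < ?m" "y \<in> K" "x = ?m *\<^sub>R y" using minkowski_is_min(1)[OF K x] by blast
  have "closed_segment 0 y \<subseteq> K" using K y(2) by (auto simp: star_body_def)
  moreover have "(?m / a) *\<^sub>R y = inverse a *\<^sub>R (?m *\<^sub>R y)" by (simp add: divide_inverse_commute)
  then have "inverse a *\<^sub>R x = (?m / a) *\<^sub>R y" unfolding y(3)[symmetric] by simp
  then have "inverse a *\<^sub>R x \<in> closed_segment 0 y"
    using le y(1) a by (auto simp: in_segment intro!: exI[of _ "?m / a"])
  ultimately show "inverse a *\<^sub>R x \<in> K" by blast
qed

lemma minkowski_pos:
  fixes K :: "'a::euclidean_space set"
  shows "\<lbrakk>star_body K; x \<noteq> 0\<rbrakk> \<Longrightarrow> 0 < minkowski K x"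
  using minkowski_is_min(1) by blast

lemma mem_iff_minkowski_le:
  fixes K :: "'a::euclidean_space set"
  shows "\<lbrakk>star_body K; x \<noteq> 0\<rbrakk> \<Longrightarrow> x \<in> K \<longleftrightarrow> minkowski K x \<le> 1"
  using minkowski_le_iff[of K x 1] by simp

lemma minkowski_zero:
  fixes K :: "'a::euclidean_space set"
  assumes "0 \<in> K"
  shows "minkowski K 0 = 0"
proof -
  have "{a. 0 < a \<and> 0 \<in> (\<lambda>y. a *\<^sub>R y) ` K} = {0<..}"
    using assms by (auto simp: image_iff intro!: bexI[of _ 0])
  then show ?thesis by (simp add: minkowski_def)
qed

lemma minkowski_scale:
  fixes K :: "'a::euclidean_space set"
  assumes K: "star_body K" and t: "t \<ge> 0"
  shows "minkowski K (t *\<^sub>R x) = t * minkowski K x"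
proof (cases "x = 0 \<or> t = 0")
  case True
  have "0 \<in> K" using K interior_subset by (auto simp: star_body_def)
  then show ?thesis using True minkowski_zero by auto
next
  case False
  with t have t: "t > 0" and x: "x \<noteq> 0" by auto
  have le: "minkowski K (t *\<^sub>R x) \<le> a \<longleftrightarrow> t * minkowski K x \<le> a" if "a > 0" for a
  proof -
    have "minkowski K (t *\<^sub>R x) \<le> a \<longleftrightarrow> inverse a *\<^sub>R t *\<^sub>R x \<in> K"
      using minkowski_le_iff[OF K _ that, of "t *\<^sub>R x"] t x by simp
    also have "inverse a *\<^sub>R t *\<^sub>R x = inverse (a / t) *\<^sub>R x" by (simp add: divide_inverse)
    also have "\<dots> \<in> K \<longleftrightarrow> minkowski K x \<le> a / t"
      using minkowski_le_iff[OF K x, of "a / t"] t that by simp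
    finally show ?thesis using t by (simp add: field_simps)
  qed
  have p: "0 < minkowski K (t *\<^sub>R x)" "0 < t * minkowski K x"
    using minkowski_pos[OF K] t x by auto
  show ?thesis using le[OF p(1)] le[OF p(2)] by linarith
qed

lemma le_radial_iff:
  fixes K :: "'a::euclidean_space set"
  assumes K: "star_body K" and "x \<noteq> 0" "t > 0"
  shows "t *\<^sub>R x \<in> K \<longleftrightarrow> t \<le> radial K x"
proof -
  have "t *\<^sub>R x \<in> K \<longleftrightarrow> t * minkowski K x \<le> 1"
    using mem_iff_minkowski_le[OF K, of "t *\<^sub>R x"] minkowski_scale[OF K, of t x] assms by simp
  then show ?thesis
    using minkowski_pos[OF K assms(2)] by (simp add: radial_def field_simps)
qed

lemma radial_pos:
  fixes K :: "'a::euclidean_space set"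
  shows "\<lbrakk>star_body K; x \<noteq> 0\<rbrakk> \<Longrightarrow> 0 < radial K x"
  by (simp add: radial_def minkowski_pos)

locale convex_star_body =
  fixes L :: "'a::euclidean_space set"
  assumes star: "star_body L" and conv: "convex L"
begin

abbreviation "m \<equiv> minkowski L"

lemmas m_pos = minkowski_pos[OF star]
lemmas m_scale = minkowski_scale[OF star]
lemmas mem_iff = mem_iff_minkowski_le[OF star]

lemma zero_mem: "0 \<in> L"
  using star interior_subset by (auto simp: star_body_def)

lemma m_zero [simp]: "m 0 = 0"
  using minkowski_zero[OF zero_mem] .

lemma m_nonneg: "0 \<le> m x"
  using m_pos[of x] by (cases "x = 0") auto

lemma normalized_mem: "x \<noteq> 0 \<Longrightarrow> inverse (m x) *\<^sub>R x \<in> L"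
  using minkowski_le_iff[OF star _ m_pos, of x x] by simp

lemma m_add: "m (x + y) \<le> m x + m y"
proof (cases "x = 0 \<or> y = 0 \<or> x + y = 0")
  case True
  then show ?thesis using m_nonneg[of x] m_nonneg[of y] by auto
next
  case False
  then have x: "x \<noteq> 0" and y: "y \<noteq> 0" and xy: "x + y \<noteq> 0" by auto
  let ?s = "m x + m y"
  have s: "?s > 0" using m_pos x y by (simp add: add_pos_pos)
  have "(m x / ?s) *\<^sub>R (inverse (m x) *\<^sub>R x) + (m y / ?s) *\<^sub>R (inverse (m y) *\<^sub>R y) \<in> L"
    by (rule convexD[OF conv normalized_mem[OF x] normalized_mem[OF y]])
      (use m_pos[OF x] m_pos[OF y] s in \<open>auto simp flip: add_divide_distrib\<close>)
  also have "(m x / ?s) *\<^sub>R (inverse (m x) *\<^sub>R x) + (m y / ?s) *\<^sub>R (inverse (m y) *\<^sub>R y) = inverse ?s *\<^sub>R (x + y)"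
    using m_pos[OF x] m_pos[OF y] by (simp add: scaleR_add_right divide_simps)
  finally show ?thesis using minkowski_le_iff[OF star xy s] by simp
qed

lemma m_bounded: "\<exists>C. \<forall>x. m x \<le> C * norm x"
proof -
  obtain e where e: "e > 0" "cball 0 e \<subseteq> L"
    using star by (auto simp: star_body_def mem_interior_cball)
  have "m x \<le> inverse e * norm x" for x
  proof (cases "x = 0")
    case False
    have "inverse (inverse e * norm x) *\<^sub>R x \<in> L"
      by (rule subsetD[OF e(2)]) (use e False in auto)
    then show ?thesis using minkowski_le_iff[OF star False, of "inverse e * norm x"] e False by simp
  qed simp
  then show ?thesis by blast
qed

lemma m_lipschitz: "\<exists>C\<ge>0. \<forall>x y. \<bar>m x - m y\<bar> \<le> C * norm (x - y)"
proof -
  obtain C where C: "\<And>x. m x \<le> C * norm x" using m_bounded by blast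
  have "\<bar>m x - m y\<bar> \<le> \<bar>C\<bar> * norm (x - y)" for x y
  proof -
    have "m x - m y \<le> C * norm (x - y)" "m y - m x \<le> C * norm (y - x)"
      using m_add[of y "x - y"] m_add[of x "y - x"] C[of "x - y"] C[of "y - x"] by auto
    moreover have "C * norm (x - y) \<le> \<bar>C\<bar> * norm (x - y)" by (simp add: mult_right_mono)
    ultimately show ?thesis by (simp add: norm_minus_commute abs_le_iff)
  qed
  then show ?thesis by (intro exI[of _ "\<bar>C\<bar>"]) auto
qed

lemma continuous_m: "continuous_on S m"
proof -
  obtain C where "C \<ge> 0" "\<And>x y. \<bar>m x - m y\<bar> \<le> C * norm (x - y)" using m_lipschitz by blast
  then have "C-lipschitz_on S m" by (intro lipschitz_onI) (auto simp: dist_norm)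
  then show ?thesis by (rule lipschitz_on_continuous_on)
qed

lemma open_m_less: "open {x. m x < c}"
  by (rule open_Collect_less) (auto intro: continuous_m)

lemma frontier_iff: "p \<in> frontier L \<longleftrightarrow> m p = 1"
proof -
  have "closed L" using star by (auto simp: star_body_def compact_imp_closed)
  then have fr: "frontier L = L - interior L" by (simp add: frontier_def)
  have i: "p \<in> interior L" if "m p < 1"
  proof (rule interiorI[OF open_m_less[of 1]])
    show "{x. m x < 1} \<subseteq> L"
    proof
      fix x assume "x \<in> {x. m x < 1}"
      then show "x \<in> L" using mem_iff[of x] zero_mem by (cases "x = 0") auto
    qed
  qed (use that in simp)
  have ni: "m p < 1" if int: "p \<in> interior L"
  proof (cases "p = 0")
    case False
    obtain e where e: "e > 0" "cball p e \<subseteq> L" using int by (metis mem_interior_cball)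
    let ?t = "1 + e / norm p"
    have t: "?t > 1" using e False by simp
    have "?t *\<^sub>R p \<in> L"
      by (rule subsetD[OF e(2)]) (use e False in \<open>auto simp: dist_norm algebra_simps\<close>)
    then have "m (?t *\<^sub>R p) \<le> 1" using False t mem_iff[of "?t *\<^sub>R p"] by auto
    then have "?t * m p \<le> 1" using m_scale[of ?t p] t by simp
    moreover have "?t * m p > 1 * m p" using t m_pos[OF False] by (intro mult_strict_right_mono)
    ultimately show ?thesis by simp
  qed simp
  have "p \<in> L \<longleftrightarrow> m p \<le> 1" using mem_iff[of p] zero_mem by (cases "p = 0") auto
  then show ?thesis using i ni unfolding fr by (metis Diff_iff order_le_less order_less_irrefl)
qed

lemma normalized: "y \<noteq> 0 \<Longrightarrow> m (inverse (m y) *\<^sub>R y) = 1"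
  using m_scale[of "inverse (m y)" y] m_pos[of y] by simp

end

text \<open>Implicit differentiation: the derivative exists because \<open>\<mu>\<close> is Lipschitz, and the same
  estimate shows that the radial derivative of \<open>\<phi>\<close> cannot vanish.\<close>

lemma implicit_radial_derivative:
  fixes \<mu> \<phi> :: "'a::euclidean_space \<Rightarrow> real"
  assumes pos: "\<mu> y > 0"
    and lip: "C \<ge> 0" "\<And>z. \<bar>\<mu> z - \<mu> y\<bar> \<le> C * norm (z - y)"
    and \<phi>: "(\<phi> has_derivative \<phi>') (at (inverse (\<mu> y) *\<^sub>R y))" "\<phi>' v0 \<noteq> 0"
    and zero: "eventually (\<lambda>z. \<phi> (inverse (\<mu> z) *\<^sub>R z) = 0) (nhds y)"
  shows "\<phi>' (inverse (\<mu> y) *\<^sub>R y) \<noteq> 0"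
    and "(\<mu> has_derivative (\<lambda>v. \<phi>' v / \<phi>' (inverse (\<mu> y) *\<^sub>R y))) (at y)"
proof -
  define h where "h z = inverse (\<mu> z) *\<^sub>R z" for z
  define \<beta> where "\<beta> = \<phi>' (h y)"
  have bl: "bounded_linear \<phi>'" using \<phi>(1) by (rule has_derivative_bounded_linear)
  then have lin: "linear \<phi>'" by (rule bounded_linear.linear)
  have "(\<mu> \<longlongrightarrow> \<mu> y) (at y)"
  proof (rule LIM_zero_cancel, rule Lim_null_comparison)
    show "\<forall>\<^sub>F z in at y. norm (\<mu> z - \<mu> y) \<le> C * norm (z - y)" using lip by simp
    show "((\<lambda>z. C * norm (z - y)) \<longlongrightarrow> 0) (at y)" by (auto intro!: tendsto_eq_intros)
  qed
  then have cont: "isCont \<mu> y" by (simp add: isCont_def)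
  then have ch: "isCont h y" unfolding h_def using pos by (intro continuous_intros) auto
  have est: "\<exists>d>0. \<forall>z. norm (z - y) < d \<longrightarrow> \<bar>\<phi>' (z - y) - (\<mu> z - \<mu> y) * \<beta>\<bar> \<le> e * norm (z - y)"
    if e: "e > 0" for e
  proof -
    let ?M = "1 + C * norm (h y)"
    have M: "?M > 0" using lip(1) by (simp add: add_pos_nonneg)
    have "\<exists>d>0. \<forall>w. norm (w - h y) < d \<longrightarrow> norm (\<phi> w - \<phi> (h y) - \<phi>' (w - h y)) \<le> (e / ?M) * norm (w - h y)"
      using \<phi>(1)[folded h_def, unfolded has_derivative_at_alt] divide_pos_pos[OF e M] by blast
    then obtain d1 where d1: "d1 > 0" "\<And>w. norm (w - h y) < d1 \<Longrightarrow> norm (\<phi> w - \<phi> (h y) - \<phi>' (w - h y)) \<le> (e / ?M) * norm (w - h y)"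
      by blast
    have "eventually (\<lambda>z. dist (h z) (h y) < d1) (nhds y)"
      using ch d1(1) by (simp add: isCont_def tendsto_iff eventually_nhds_conv_at)
    moreover have "eventually (\<lambda>z. dist (\<mu> z) (\<mu> y) < \<mu> y) (nhds y)"
      using cont pos by (simp add: isCont_def tendsto_iff eventually_nhds_conv_at)
    ultimately have "eventually (\<lambda>z. dist (h z) (h y) < d1 \<and> dist (\<mu> z) (\<mu> y) < \<mu> y \<and> \<phi> (h z) = 0) (nhds y)"
      using zero unfolding h_def by eventually_elim auto
    then obtain d where d: "d > 0" "\<And>z. dist z y < d \<Longrightarrow> dist (h z) (h y) < d1 \<and> dist (\<mu> z) (\<mu> y) < \<mu> y \<and> \<phi> (h z) = 0"
      by (auto simp: eventually_nhds_metric)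
    show ?thesis
    proof (intro exI[of _ d] conjI d allI impI)
      fix z assume "norm (z - y) < d"
      then have z: "norm (h z - h y) < d1" "\<mu> z > 0" "\<phi> (h z) = 0" "\<phi> (h y) = 0"
        using d(2)[of z] d(2)[of y] d(1) by (auto simp: dist_norm)
      have id: "\<mu> z *\<^sub>R (h z - h y) = (z - y) - (\<mu> z - \<mu> y) *\<^sub>R h y"
        using z(2) pos by (simp add: h_def algebra_simps)
      have "\<phi>' (z - y) - (\<mu> z - \<mu> y) * \<beta> = \<mu> z * \<phi>' (h z - h y)"
        using arg_cong[OF id, of \<phi>'] lin by (simp add: linear_diff linear_cmul \<beta>_def)
      then have "\<bar>\<phi>' (z - y) - (\<mu> z - \<mu> y) * \<beta>\<bar> = \<mu> z * \<bar>\<phi>' (h z - h y)\<bar>"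
        using z(2) by (simp add: abs_mult)
      also have "\<dots> \<le> \<mu> z * ((e / ?M) * norm (h z - h y))"
        using d1(2)[OF z(1)] z by (intro mult_left_mono) auto
      also have "\<dots> = (e / ?M) * norm (\<mu> z *\<^sub>R (h z - h y))" using z(2) by simp
      also have "\<dots> \<le> (e / ?M) * (?M * norm (z - y))"
      proof (rule mult_left_mono)
        have "norm (\<mu> z *\<^sub>R (h z - h y)) \<le> norm (z - y) + \<bar>\<mu> z - \<mu> y\<bar> * norm (h y)"
          unfolding id using norm_triangle_ineq4[of "z - y" "(\<mu> z - \<mu> y) *\<^sub>R h y"] by simp
        also have "\<dots> \<le> norm (z - y) + (C * norm (z - y)) * norm (h y)"
          by (intro add_left_mono mult_right_mono lip) auto
        finally show "norm (\<mu> z *\<^sub>R (h z - h y)) \<le> ?M * norm (z - y)" by (simp add: algebra_simps)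
      qed (use e M in auto)
      also have "\<dots> = e * norm (z - y)" using M by simp
      finally show "\<bar>\<phi>' (z - y) - (\<mu> z - \<mu> y) * \<beta>\<bar> \<le> e * norm (z - y)" .
    qed
  qed
  show \<beta>: "\<phi>' (inverse (\<mu> y) *\<^sub>R y) \<noteq> 0"
  proof
    assume "\<phi>' (inverse (\<mu> y) *\<^sub>R y) = 0"
    then have "\<beta> = 0" by (simp add: \<beta>_def h_def)
    then have "((\<lambda>z. 0::real) has_derivative \<phi>') (at y)"
      unfolding has_derivative_at_alt using est bl by simp
    then have "\<phi>' = (\<lambda>_. 0)" using has_derivative_unique has_derivative_const by blast
    then show False using \<phi>(2) by simp
  qed
  then have b: "\<bar>\<beta>\<bar> > 0" by (simp add: \<beta>_def h_def)
  have "(\<mu> has_derivative (\<lambda>v. \<phi>' v / \<beta>)) (at y)"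
    unfolding has_derivative_at_alt
  proof (intro conjI allI impI)
    show "bounded_linear (\<lambda>v. \<phi>' v / \<beta>)"
      using bounded_linear_compose[OF bounded_linear_divide bl] .
    fix e :: real assume "e > 0"
    then obtain d where d: "d > 0" "\<And>z. norm (z - y) < d \<Longrightarrow> \<bar>\<phi>' (z - y) - (\<mu> z - \<mu> y) * \<beta>\<bar> \<le> (e * \<bar>\<beta>\<bar>) * norm (z - y)"
      using est[of "e * \<bar>\<beta>\<bar>"] b by auto
    have "norm (\<mu> z - \<mu> y - \<phi>' (z - y) / \<beta>) \<le> e * norm (z - y)" if "norm (z - y) < d" for z
    proof -
      have "\<bar>\<beta>\<bar> * norm (\<mu> z - \<mu> y - \<phi>' (z - y) / \<beta>) = \<bar>\<phi>' (z - y) - (\<mu> z - \<mu> y) * \<beta>\<bar>"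
      proof -
        have "\<beta> * (\<mu> z - \<mu> y - \<phi>' (z - y) / \<beta>) = - (\<phi>' (z - y) - (\<mu> z - \<mu> y) * \<beta>)"
          using b by (simp add: field_simps)
        then have "\<bar>\<beta> * (\<mu> z - \<mu> y - \<phi>' (z - y) / \<beta>)\<bar> = \<bar>\<phi>' (z - y) - (\<mu> z - \<mu> y) * \<beta>\<bar>" by simp
        then show ?thesis by (simp only: abs_mult real_norm_def)
      qed
      also have "\<dots> \<le> \<bar>\<beta>\<bar> * (e * norm (z - y))" using d(2)[OF that] by (simp add: algebra_simps)
      finally show ?thesis using b by simp
    qed
    then show "\<exists>d>0. \<forall>z. norm (z - y) < d \<longrightarrow> norm (\<mu> z - \<mu> y - \<phi>' (z - y) / \<beta>) \<le> e * norm (z - y)"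
      using d(1) by blast
  qed
  then show "(\<mu> has_derivative (\<lambda>v. \<phi>' v / \<phi>' (inverse (\<mu> y) *\<^sub>R y))) (at y)"
    by (simp add: \<beta>_def h_def)
qed

locale smooth_convex_body = convex_star_body +
  assumes smooth: "smooth_hypersurface (frontier L)"
begin

lemma Ck_on_m: "Ck_on k m (- {0})"
proof (rule Ck_on_local)
  fix y :: 'a assume "y \<in> - {0}"
  then have y: "y \<noteq> 0" by simp
  define P where "P z = inverse (m z) *\<^sub>R z" for z
  have Pfr: "P z \<in> frontier L" if "z \<noteq> 0" for z
    using frontier_iff normalized[OF that] by (simp add: P_def)
  obtain U and \<phi> :: "'a \<Rightarrow> real" where U\<phi>: "open U \<and> P y \<in> U \<and> smooth_on \<phi> U \<and>
      (\<forall>x\<in>frontier L \<inter> U. \<exists>v. frechet_derivative \<phi> (at x) v \<noteq> 0) \<and>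
      frontier L \<inter> U = {x \<in> U. \<phi> x = 0}"
    using bspec[OF smooth[unfolded smooth_hypersurface_def] Pfr[OF y]] by (elim exE)
  then have U: "open U" "P y \<in> U" "smooth_on \<phi> U"
    "\<And>x. x \<in> frontier L \<inter> U \<Longrightarrow> \<exists>v. frechet_derivative \<phi> (at x) v \<noteq> 0"
    "frontier L \<inter> U = {x \<in> U. \<phi> x = 0}"
    by simp_all
  define V where "V = (- {0}) \<inter> P -` U"
  have mz: "m z \<noteq> 0" if "z \<in> V" for z using that m_pos[of z] by (auto simp: V_def)
  have cP: "continuous_on (- {0}) P"
    unfolding P_def using m_pos by (intro continuous_intros continuous_m) force
  then have V: "open V" unfolding V_def
    by (rule continuous_open_preimage) (use U in auto)
  have C\<phi>: "Ck_on k \<phi> U" for k using U(3) by (simp add: smooth_on_def)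
  obtain C where lip: "C \<ge> 0" "\<And>x y. \<bar>m x - m y\<bar> \<le> C * norm (x - y)" using m_lipschitz by blast
  let ?d = "\<lambda>z v. dderiv \<phi> v (P z)"
  have D: "?d z (P z) \<noteq> 0 \<and> (m has_derivative (\<lambda>v. ?d z v / ?d z (P z))) (at z)" if z: "z \<in> V" for z
  proof -
    have z0: "z \<noteq> 0" and zU: "P z \<in> U" using z by (auto simp: V_def)
    obtain v0 where v0: "?d z v0 \<noteq> 0" using U(4)[of "P z"] Pfr[OF z0] zU by (auto simp: dderiv_def)
    have hd: "(\<phi> has_derivative (\<lambda>v. ?d z v)) (at (inverse (m z) *\<^sub>R z))"
      using has_derivative_dderiv[OF C\<phi>[of "Suc 0"] zU] by (simp add: P_def)
    have "\<phi> (P x) = 0" if "x \<in> V" for x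
    proof -
      have "P x \<in> frontier L \<inter> U" using Pfr[of x] that by (simp add: V_def)
      then show ?thesis unfolding U(5) by simp
    qed
    then have ev: "eventually (\<lambda>x. \<phi> (inverse (m x) *\<^sub>R x) = 0) (nhds z)"
      unfolding eventually_nhds using V z by (auto simp: P_def)
    from implicit_radial_derivative[OF m_pos[OF z0] lip(1) lip(2) hd v0 ev]
    show ?thesis by (simp add: P_def)
  qed
  have "Ck_on k m V"
  proof (induction k)
    case 0
    then show ?case using continuous_m by simp
  next
    case (Suc k)
    have CP: "Ck_on k P V" unfolding P_def
      by (rule Ck_on_scaleR[OF V Ck_on_inverse[OF V Suc mz] Ck_on_linear[OF bounded_linear_ident V]])
    have Cd: "Ck_on k (\<lambda>z. ?d z v) V" for v
      by (rule Ck_on_compose[OF V Ck_on_dderiv[OF C\<phi>[of "Suc k"]] CP]) (auto simp: V_def)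
    have eq: "?d z (P z) = (\<Sum>b\<in>Basis. (P z \<bullet> b) * ?d z b)" if "z \<in> V" for z
      by (rule linear_Basis_expansion[OF linear_dderiv[OF C\<phi>[of "Suc 0"]]]) (use that in \<open>auto simp: V_def\<close>)
    have "Ck_on k (\<lambda>z. \<Sum>b\<in>Basis. (P z \<bullet> b) * ?d z b) V"
      by (rule Ck_on_sum[OF V Ck_on_mult[OF V Ck_on_bounded_linear[OF bounded_linear_inner_left V CP] Cd]])
    then have CdP: "Ck_on k (\<lambda>z. ?d z (P z)) V"
      by (rule Ck_on_cong[OF V, rotated]) (simp add: eq)
    show ?case
    proof (rule Ck_onI_Suc[OF V])
      show "(m has_derivative (\<lambda>v. ?d z v / ?d z (P z))) (at z)" if "z \<in> V" for z using D[OF that] by blast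
      show "Ck_on k (\<lambda>z. ?d z v / ?d z (P z)) V" for v
        by (rule Ck_on_divide[OF V Cd CdP]) (use D in blast)
    qed
  qed
  then show "\<exists>V. open V \<and> y \<in> V \<and> Ck_on k m V" using V y U(2) by (auto simp: V_def)
qed

end

lemma star_body_of_symmetric_convex_body:
  assumes "convex_body L" "origin_symmetric L"
  shows "star_body L"
proof -
  obtain z where z: "z \<in> interior L" using assms(1) by (auto simp: convex_body_def)
  have "uminus ` interior L = interior L"
    using interior_negations[of L] assms(2) by (simp add: origin_symmetric_def)
  then have "- z \<in> interior L" using z by blast
  moreover have "convex (interior L)" using assms(1) by (simp add: convex_body_def convex_interior)
  ultimately have "(1/2) *\<^sub>R z + (1/2) *\<^sub>R (- z) \<in> interior L" using z by (intro convexD) auto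
  then have 0: "0 \<in> interior L" by simp
  moreover have "closed_segment 0 x \<subseteq> L" if "x \<in> L" for x
    using assms(1) 0 that interior_subset by (intro closed_segment_subset) (auto simp: convex_body_def)
  ultimately show ?thesis using assms(1) by (simp add: star_body_def convex_body_def)
qed

lemma dderiv_homogeneous:
  fixes f :: "'a::euclidean_space \<Rightarrow> real"
  assumes f: "Ck_on (Suc k) f (- {0})" and hom: "\<And>z. z \<noteq> 0 \<Longrightarrow> f (t *\<^sub>R z) = c * f z"
    and "t \<noteq> 0" "x \<noteq> 0"
  shows "t * dderiv f v (t *\<^sub>R x) = c * dderiv f v x"
proof -
  have 1: "((\<lambda>z. f (t *\<^sub>R z)) has_derivative (\<lambda>v. dderiv f (t *\<^sub>R v) (t *\<^sub>R x))) (at x)"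
    by (rule has_derivative_compose[where f="\<lambda>z. t *\<^sub>R z" and g=f, OF _ has_derivative_dderiv[OF f]])
      (use assms in \<open>auto intro!: derivative_eq_intros\<close>)
  have "((\<lambda>z. c * f z) has_derivative (\<lambda>v. c * dderiv f v x)) (at x)"
    using has_derivative_dderiv[OF f, of x] assms(4) by (intro has_derivative_mult_right) auto
  then have "((\<lambda>z. f (t *\<^sub>R z)) has_derivative (\<lambda>v. c * dderiv f v x)) (at x)"
    by (rule has_derivative_transform_within_open[of _ _ _ _ "- {0}"]) (use assms in auto)
  from has_derivative_unique[OF 1 this] have "dderiv f (t *\<^sub>R v) (t *\<^sub>R x) = c * dderiv f v x"
    by (rule fun_cong)
  then show ?thesis using linear_cmul[OF linear_dderiv[OF f, of "t *\<^sub>R x"], of t v] assms by simp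
qed

lemma line_avoids_zero:
  fixes y v :: "'a::real_normed_vector"
  assumes "y \<noteq> 0"
  obtains d where "d > 0" "\<And>r. \<bar>r\<bar> < d \<Longrightarrow> y + r *\<^sub>R v \<noteq> 0"
proof
  have nv: "norm v + 1 > 0" by (simp add: add_nonneg_pos)
  show "norm y / (norm v + 1) > 0" using assms nv by simp
  fix r assume r: "\<bar>r\<bar> < norm y / (norm v + 1)"
  have "\<bar>r\<bar> * norm v \<le> \<bar>r\<bar> * (norm v + 1)" by (simp add: mult_left_mono)
  also have "\<dots> < norm y" using r nv by (simp add: field_simps)
  finally have "norm (r *\<^sub>R v) < norm y" by simp
  then show "y + r *\<^sub>R v \<noteq> 0" by (metis add_eq_0_iff norm_minus_cancel order_less_irrefl)
qed

context smooth_convex_body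
begin

abbreviation "Dm v y \<equiv> dderiv m v y"
abbreviation "D2m v w y \<equiv> dderiv (dderiv m v) w y"

lemmas linear_Dm = linear_dderiv[OF Ck_on_m[of "Suc 0"]]

lemma Ck_on_2_m: "Ck_on 2 m (- {0})"
  by (rule Ck_on_m)

lemma Ck_on_Dm: "Ck_on k (dderiv m v) (- {0})"
  by (rule Ck_on_dderiv[OF Ck_on_m])

lemma Dm_line:
  "y \<noteq> 0 \<Longrightarrow> ((\<lambda>r. m (y + r *\<^sub>R v)) has_real_derivative Dm v y) (at 0)"
  using dderiv_line[OF Ck_on_m[of "Suc 0"], of y 0 v] by simp

lemma D2m_line:
  "y \<noteq> 0 \<Longrightarrow> ((\<lambda>r. Dm v (y + r *\<^sub>R w)) has_real_derivative D2m v w y) (at 0)"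
  using dderiv_line[OF Ck_on_Dm[of "Suc 0"], of y 0 w] by simp

lemma Dm_scale: "\<lbrakk>t > 0; y \<noteq> 0\<rbrakk> \<Longrightarrow> Dm v (t *\<^sub>R y) = Dm v y"
  using dderiv_homogeneous[OF Ck_on_m[of "Suc 0"], where t=t and c=t and x=y and v=v] m_scale[of t] by auto

lemma D2m_scale: "\<lbrakk>t > 0; y \<noteq> 0\<rbrakk> \<Longrightarrow> t * D2m v w (t *\<^sub>R y) = D2m v w y"
  using dderiv_homogeneous[OF Ck_on_Dm[of "Suc 0"], where t=t and c=1 and x=y and v=w] Dm_scale[of t] by auto

lemma Dm_self: "y \<noteq> 0 \<Longrightarrow> Dm y y = m y"
proof -
  assume y: "y \<noteq> 0"
  have "((\<lambda>r. m (y + r *\<^sub>R y)) has_real_derivative m y) (at 0)"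
  proof (rule DERIV_cong[OF has_field_derivative_transform_within_open[of "\<lambda>r. (1 + r) * m y" _ _ "{-1<..}"]])
    show "((\<lambda>r. (1 + r) * m y) has_real_derivative (1 * m y)) (at 0)"
      by (auto intro!: derivative_eq_intros)
    show "(1 + r) * m y = m (y + r *\<^sub>R y)" if "r \<in> {-1<..}" for r
      using m_scale[of "1 + r" y] that by (simp add: scaleR_add_left)
  qed auto
  then show ?thesis using DERIV_unique[OF Dm_line[OF y]] by blast
qed

lemma Dm_le: "y \<noteq> 0 \<Longrightarrow> Dm v y \<le> m v"
proof (rule ccontr)
  assume y: "y \<noteq> 0" and "\<not> Dm v y \<le> m v"
  then have pos: "Dm v y - m v > 0" by simp
  have "((\<lambda>r. m (y + r *\<^sub>R v) - r * m v) has_real_derivative Dm v y - m v) (at 0)"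
    by (auto intro!: derivative_eq_intros Dm_line y)
  from DERIV_pos_inc_right[OF this pos] obtain d where d: "d > 0"
    "\<And>h. \<lbrakk>0 < h; h < d\<rbrakk> \<Longrightarrow> m y < m (y + h *\<^sub>R v) - h * m v" by auto
  have "m y < m (y + (d/2) *\<^sub>R v) - (d/2) * m v" by (rule d(2)) (use d(1) in auto)
  then show False using m_add[of y "(d/2) *\<^sub>R v"] m_scale[of "d/2" v] d(1) by simp
qed

lemma m_above_tangent: "y \<noteq> 0 \<Longrightarrow> m y + Dm (z - y) y \<le> m z"
  using Dm_le[of y z] Dm_self[of y] linear_diff[OF linear_Dm, of y z y] by simp

lemma Dm_mono: 
  assumes "y \<noteq> 0" "y + r *\<^sub>R v \<noteq> 0" "r > 0"
  shows "Dm v y \<le> Dm v (y + r *\<^sub>R v)"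
proof -
  have "m y + r * Dm v y \<le> m (y + r *\<^sub>R v)"
    using m_above_tangent[of y "y + r *\<^sub>R v"] linear_cmul[OF linear_Dm, of y r v] assms by simp
  moreover have "m (y + r *\<^sub>R v) - r * Dm v (y + r *\<^sub>R v) \<le> m y"
    using m_above_tangent[of "y + r *\<^sub>R v" y] linear_cmul[OF linear_Dm, of "y + r *\<^sub>R v" "- r" v] assms by simp
  ultimately have "r * Dm v y \<le> r * Dm v (y + r *\<^sub>R v)" by linarith
  then show ?thesis using assms(3) by simp
qed

lemma D2m_nonneg: "y \<noteq> 0 \<Longrightarrow> 0 \<le> D2m v v y"
proof (rule ccontr)
  assume y: "y \<noteq> 0" and "\<not> 0 \<le> D2m v v y"
  then have neg: "D2m v v y < 0" by simp
  obtain d1 where d1: "d1 > 0" "\<And>r. \<bar>r\<bar> < d1 \<Longrightarrow> y + r *\<^sub>R v \<noteq> 0" using line_avoids_zero[OF y, of v] by blast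
  from DERIV_neg_dec_right[OF D2m_line[OF y] neg] obtain d where d: "d > 0"
    "\<And>h. \<lbrakk>0 < h; h < d\<rbrakk> \<Longrightarrow> Dm v (y + h *\<^sub>R v) < Dm v y" by auto
  define h where "h = min d d1 / 2"
  have h: "0 < h" "h < d" "h < d1" using d(1) d1(1) by (auto simp: h_def)
  show False using d(2)[of h] Dm_mono[OF y d1(2), of h] h by simp
qed

definition "\<nu> y = (\<Sum>b\<in>Basis. Dm b y *\<^sub>R b)"

lemma inner_\<nu>: "y \<noteq> 0 \<Longrightarrow> \<nu> y \<bullet> v = Dm v y"
  using linear_Basis_expansion[OF linear_Dm, of y v]
  by (simp add: \<nu>_def inner_sum_left inner_commute[of v] mult.commute)

lemma has_derivative_\<nu>:
  "y \<noteq> 0 \<Longrightarrow> (\<nu> has_derivative (\<lambda>w. \<Sum>b\<in>Basis. D2m b w y *\<^sub>R b)) (at y)"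
  unfolding \<nu>_def
  by (intro has_derivative_sum has_derivative_scaleR_left has_derivative_dderiv[OF Ck_on_Dm[of "Suc 0"]]) auto

lemma \<nu>_nonzero: "y \<noteq> 0 \<Longrightarrow> \<nu> y \<noteq> 0"
  using inner_\<nu>[of y y] Dm_self[of y] m_pos[of y] by auto

lemma outer_normal_eq:
  assumes p: "p \<in> frontier L"
  shows "outer_normal L p = sgn (\<nu> p)"
proof -
  have mp: "m p = 1" using p frontier_iff by simp
  then have p0: "p \<noteq> 0" by auto
  show ?thesis
    unfolding outer_normal_def
  proof (rule the_equality)
    have "\<nu> p \<bullet> (z - p) \<le> 0" if "z \<in> L" for z
    proof -
      have "m z \<le> 1" using that mem_iff[of z] by (cases "z = 0") auto
      then show ?thesis using inner_\<nu>[OF p0] m_above_tangent[OF p0, of z] mp by simp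
    qed
    then show "norm (sgn (\<nu> p)) = 1 \<and> (\<forall>z\<in>L. sgn (\<nu> p) \<bullet> (z - p) \<le> 0)"
      using \<nu>_nonzero[OF p0] by (simp add: norm_sgn sgn_div_norm mult_le_0_iff)
  next
    fix u assume u: "norm u = 1 \<and> (\<forall>z\<in>L. u \<bullet> (z - p) \<le> 0)"
    have le: "u \<bullet> z \<le> (u \<bullet> p) * m z" for z
    proof (cases "z = 0")
      case False
      have "u \<bullet> (inverse (m z) *\<^sub>R z - p) \<le> 0" using u normalized_mem[OF False] by blast
      then show ?thesis using m_pos[OF False] by (simp add: inner_diff_right field_simps)
    qed simp
    have "((\<lambda>z. (u \<bullet> p) * m z - u \<bullet> z) has_derivative (\<lambda>v. (u \<bullet> p) * Dm v p - u \<bullet> v)) (at p)"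
      using has_derivative_dderiv[OF Ck_on_m[of "Suc 0"], of p] p0
      by (intro has_derivative_diff has_derivative_mult_right has_derivative_inner_right has_derivative_ident) auto
    then have "(\<lambda>v. (u \<bullet> p) * Dm v p - u \<bullet> v) = (\<lambda>v. 0)"
      by (rule has_derivative_local_min) (use le mp in simp)
    then have "u \<bullet> v = ((u \<bullet> p) *\<^sub>R \<nu> p) \<bullet> v" for v
      using inner_\<nu>[OF p0, of v] by (metis (no_types) eq_iff_diff_eq_0 inner_scaleR_left)
    then have eq: "u = (u \<bullet> p) *\<^sub>R \<nu> p" by (metis vector_eq_ldot inner_commute)
    have "u \<bullet> (0 - p) \<le> 0" using u zero_mem by blast
    moreover have "u \<bullet> p \<noteq> 0" using eq u by force
    ultimately have "sgn (u \<bullet> p) = 1" by simp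
    then have "sgn u = sgn (\<nu> p)" by (subst eq) (simp add: sgn_scaleR)
    then show "u = sgn (\<nu> p)" using u by (simp add: sgn_div_norm)
  qed
qed

lemma has_derivative_outer_normal:
  assumes p: "p \<in> frontier L" and v: "\<And>w. D2m w v p = 0"
  obtains A where "(outer_normal L has_derivative A) (at p within frontier L)" "A v = 0"
proof -
  have p0: "p \<noteq> 0" using p frontier_iff by auto
  let ?\<nu>' = "\<lambda>w. \<Sum>b\<in>Basis. D2m b w p *\<^sub>R b"
  note d = has_derivative_\<nu>[OF p0] 
  note dn = has_derivative_compose[OF d has_derivative_norm[OF \<nu>_nonzero[OF p0]]]
  let ?A = "\<lambda>w. inverse (norm (\<nu> p)) *\<^sub>R ?\<nu>' w + (- (inverse (norm (\<nu> p)) * (?\<nu>' w \<bullet> sgn (\<nu> p)) * inverse (norm (\<nu> p)))) *\<^sub>R \<nu> p"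
  have "((\<lambda>y. inverse (norm (\<nu> y)) *\<^sub>R \<nu> y) has_derivative ?A) (at p)"
    by (rule has_derivative_scaleR[OF Deriv.has_derivative_inverse[OF _ dn] d]) (use \<nu>_nonzero[OF p0] in simp)
  then have "((\<lambda>y. inverse (norm (\<nu> y)) *\<^sub>R \<nu> y) has_derivative ?A) (at p within frontier L)"
    by (rule has_derivative_at_withinI)
  then have "(outer_normal L has_derivative ?A) (at p within frontier L)"
    by (rule has_derivative_transform[OF p, rotated]) (simp add: outer_normal_eq sgn_div_norm)
  moreover have "?A v = 0" using v by simp
  ultimately show ?thesis by (rule that)
qed

lemma tangent_derivative_unique:
  assumes p: "p \<in> frontier L" and v: "Dm v p = 0"
    and A: "(F has_derivative A) (at p within frontier L)"
    and B: "(F has_derivative B) (at p within frontier L)"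
  shows "A v = B v"
proof -
  have mp: "m p = 1" using p frontier_iff by simp
  then have p0: "p \<noteq> 0" by auto
  define \<gamma> where "\<gamma> t = inverse (m (p + t *\<^sub>R v)) *\<^sub>R (p + t *\<^sub>R v)" for t
  define S where "S = {t. p + t *\<^sub>R v \<noteq> 0}"
  have S: "open S" "0 \<in> S"
    using p0 unfolding S_def by (auto intro!: open_Collect_neq continuous_intros)
  have \<gamma>0: "\<gamma> 0 = p" using mp by (simp add: \<gamma>_def)
  have \<gamma>S: "\<gamma> ` S \<subseteq> frontier L"
    using frontier_iff normalized by (auto simp: \<gamma>_def S_def)
  have "((\<lambda>t. m (p + t *\<^sub>R v)) has_derivative (\<lambda>t. 0)) (at 0)"
    using Dm_line[OF p0, of v] v by (simp add: has_field_derivative_def lambda_zero)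
  then have "(\<gamma> has_derivative (\<lambda>t. t *\<^sub>R v)) (at 0)"
    unfolding \<gamma>_def using mp by (auto intro!: derivative_eq_intros)
  then have \<gamma>: "(\<gamma> has_derivative (\<lambda>t. t *\<^sub>R v)) (at 0 within S)"
    by (rule has_derivative_at_withinI)
  have "((\<lambda>t. F (\<gamma> t)) has_derivative (\<lambda>t. C (t *\<^sub>R v))) (at 0)"
    if C: "(F has_derivative C) (at p within frontier L)" for C
  proof -
    have "(F has_derivative C) (at (\<gamma> 0) within \<gamma> ` S)"
      unfolding \<gamma>0 by (rule has_derivative_subset[OF C \<gamma>S])
    from has_derivative_in_compose[OF \<gamma> this] show ?thesis
      using at_within_open[OF S(2,1)] by simp
  qed
  from has_derivative_unique[OF this[OF A] this[OF B]] have "A (1 *\<^sub>R v) = B (1 *\<^sub>R v)"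
    by (rule fun_cong)
  then show ?thesis by simp
qed

end

lemma second_derivative_pos:
  fixes L :: "(real^'n) set"
  assumes "star_body L" "convex L" and curv: "smooth_positive_curvature L"
    and y: "y \<noteq> 0" and v: "v \<noteq> 0" "dderiv (minkowski L) v y = 0"
  shows "0 < dderiv (dderiv (minkowski L) v) v y"
proof (rule ccontr)
  interpret smooth_convex_body L
    by unfold_locales (use assms in \<open>auto simp: smooth_positive_curvature_def\<close>)
  assume "\<not> 0 < dderiv (dderiv (minkowski L) v) v y"
  then have zero: "D2m v v y = 0" using D2m_nonneg[OF y, of v] by simp
  have o: "open (- {0::real^'n})" by auto
  have y': "y \<in> - {0}" using y by simp
  define p where "p = inverse (m y) *\<^sub>R y"
  have p: "p \<in> frontier L" using normalized[OF y] frontier_iff by (simp add: p_def)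
  have p0: "p \<noteq> 0" using p frontier_iff by auto
  have im: "inverse (m y) > 0" using m_pos[OF y] by simp
  have null: "D2m v w y = 0" for w
    by (rule psd_form_null_vector[where B="\<lambda>v w. D2m v w y"])
      (use linear_dderiv2(2)[OF o Ck_on_2_m y'] dderiv_commute[OF o Ck_on_2_m y'] D2m_nonneg[OF y] zero in auto)
  have "D2m w v y = 0" for w
    using null[of w] dderiv_commute[OF o Ck_on_2_m y', of w v] by simp
  then have D2p: "D2m w v p = 0" for w
    using D2m_scale[OF im y, of w v] im by (auto simp: p_def)
  have Dp: "Dm v p = 0" using Dm_scale[OF im y] v(2) by (simp add: p_def)
  let ?N = "outer_normal L"
  let ?dN = "frechet_derivative ?N (at p within frontier L)"
  let ?F = "\<lambda>w. ?dN (w - (w \<bullet> ?N p) *\<^sub>R ?N p) + (w \<bullet> ?N p) *\<^sub>R ?N p"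
  obtain A where A: "(?N has_derivative A) (at p within frontier L)" "A v = 0"
    using has_derivative_outer_normal[OF p D2p] by blast
  then have dN: "(?N has_derivative ?dN) (at p within frontier L)"
    by (metis differentiable_def frechet_derivative_works)
  have "?dN v = 0" using tangent_derivative_unique[OF p Dp dN A(1)] A(2) by simp
  moreover have "v \<bullet> ?N p = 0"
    using inner_\<nu>[OF p0, of v] Dp by (simp add: outer_normal_eq[OF p] sgn_div_norm inner_commute)
  ultimately have "?F v = 0" by simp
  have bl: "linear ?dN" using has_derivative_linear[OF dN] .
  have lin: "linear ?F"
    by (rule linearI) (simp_all add: linear_diff[OF bl] linear_add[OF bl] linear_cmul[OF bl] inner_add_left algebra_simps)
  have "det (matrix ?F) > 0"
    using curv p by (simp add: smooth_positive_curvature_def gauss_curvature_def Let_def)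
  then have inj: "inj ?F" using det_nz_iff_inj[OF lin] by simp
  have "?F v = ?F 0" using \<open>?F v = 0\<close> linear_0[OF bl] by simp
  from injD[OF inj this] show False using v(1) by simp
qed

section \<open>Perturbed bodies\<close>

lemma convex_if_no_inner_touching:
  fixes D :: "'a::euclidean_space set"
  assumes "closed D"
    and shrink: "\<And>y u. \<lbrakk>y \<in> D; 0 \<le> u; u < 1\<rbrakk> \<Longrightarrow> u *\<^sub>R y \<in> interior D"
    and touch: "\<And>q v d. \<lbrakk>q \<in> D; q \<notin> interior D; norm v = 1; d > 0\<rbrakk> \<Longrightarrow> \<exists>r. \<bar>r\<bar> < d \<and> q + r *\<^sub>R v \<notin> D"
  shows "convex D"
  unfolding convex_contains_segment
proof (intro ballI)
  fix a b assume ab: "a \<in> D" "b \<in> D"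
  show "closed_segment a b \<subseteq> D"
  proof (cases "a = b")
    case False
    define \<Lambda> where "\<Lambda> = {0..1} \<inter> (\<Inter>z\<in>closed_segment a b. (\<lambda>l. l *\<^sub>R z) -` D)"
    have "closed ((\<lambda>l. l *\<^sub>R z) -` D)" for z
      using assms(1) by (intro continuous_closed_vimage continuous_intros)
    then have cL: "compact \<Lambda>"
      unfolding \<Lambda>_def by (intro compact_Int_closed closed_INT) auto
    have "0 \<in> D" using shrink[OF ab(1), of 0] interior_subset by auto
    then have "0 \<in> \<Lambda>" by (simp add: \<Lambda>_def)
    then obtain l where l: "l \<in> \<Lambda>" "\<And>k. k \<in> \<Lambda> \<Longrightarrow> k \<le> l"
      using compact_attains_sup[OF cL] by blast
    have lD: "l *\<^sub>R z \<in> D" if "z \<in> closed_segment a b" for z using l(1) that by (auto simp: \<Lambda>_def)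
    have l01: "0 \<le> l" "l \<le> 1" using l(1) by (auto simp: \<Lambda>_def)
    have "l = 1"
    proof (rule ccontr)
      assume "l \<noteq> 1"
      then have l1: "l < 1" using l01 by simp
      define T where "T = (\<lambda>z. l *\<^sub>R z) ` closed_segment a b"
      have "\<not> T \<subseteq> interior D"
      proof
        assume sub: "T \<subseteq> interior D"
        have cT: "compact T" unfolding T_def by (intro compact_scaling compact_segment)
        obtain e where e: "e > 0" "(\<Union>x\<in>T. ball x e) \<subseteq> interior D"
          using compact_subset_open_imp_ball_epsilon_subset[OF cT open_interior sub] by blast
        obtain B where B: "B > 0" "\<And>z. z \<in> closed_segment a b \<Longrightarrow> norm z \<le> B"
          using bounded_closed_segment[of a b] by (auto simp: bounded_pos)
        define k where "k = l + min (1 - l) (e / (2 * B))"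
        have k: "l < k" "k \<le> 1" "(k - l) * B < e"
        proof -
          show "l < k" "k \<le> 1" using l1 e(1) B(1) by (auto simp: k_def)
          have "(k - l) * B \<le> (e / (2 * B)) * B" using B(1) by (intro mult_right_mono) (auto simp: k_def)
          then show "(k - l) * B < e" using e(1) B(1) by simp
        qed
        have "k *\<^sub>R z \<in> D" if z: "z \<in> closed_segment a b" for z
        proof -
          have "dist (l *\<^sub>R z) (k *\<^sub>R z) = (k - l) * norm z"
            using k(1) by (simp add: dist_norm norm_minus_commute flip: scaleR_left_diff_distrib)
          also have "\<dots> \<le> (k - l) * B" using B(2)[OF z] k(1) by (intro mult_left_mono) auto
          finally have "k *\<^sub>R z \<in> ball (l *\<^sub>R z) e" using k(3) by simp
          moreover have "l *\<^sub>R z \<in> T" unfolding T_def using z by (rule imageI)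
          ultimately show ?thesis using e(2) interior_subset by blast
        qed
        then have "k \<in> \<Lambda>" using k l01 by (auto simp: \<Lambda>_def)
        then show False using l(2) k(1) by force
      qed
      then obtain z where z: "z \<in> closed_segment a b" "l *\<^sub>R z \<notin> interior D" by (auto simp: T_def)
      have "z \<noteq> a" "z \<noteq> b" using shrink[OF _ l01(1) l1] ab z(2) by auto
      have "l \<noteq> 0" using z(2) shrink[OF ab(1), of 0] by auto
      then have l0: "l > 0" using l01 by simp
      obtain s where s: "0 \<le> s" "s \<le> 1" "z = (1 - s) *\<^sub>R a + s *\<^sub>R b" using z(1) by (auto simp: in_segment)
      have s01: "0 < s" "s < 1" using s \<open>z \<noteq> a\<close> \<open>z \<noteq> b\<close> by (auto simp: order_less_le)
      define N where "N = norm (b - a)"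
      have N: "N > 0" using False by (simp add: N_def)
      let ?d = "l * N * min s (1 - s)" and ?v = "(1 / N) *\<^sub>R (b - a)"
      have d: "?d > 0" using l0 N s01 by simp
      have v: "norm ?v = 1" using N by (simp add: N_def)
      obtain r where r: "\<bar>r\<bar> < ?d" "l *\<^sub>R z + r *\<^sub>R ?v \<notin> D"
        using touch[OF lD[OF z(1)] z(2) v d] by blast
      define s' where "s' = s + r / (l * N)"
      have "\<bar>r\<bar> / (l * N) < min s (1 - s)"
        using r(1) l0 N by (subst pos_divide_less_eq) (simp_all only: mult_pos_pos mult.commute)
      then have "\<bar>r / (l * N)\<bar> < min s (1 - s)" using l0 N by (simp add: abs_divide)
      then have s': "0 \<le> s'" "s' \<le> 1" by (simp_all add: s'_def abs_less_iff del: abs_divide)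
      have "(1 - s') *\<^sub>R a + s' *\<^sub>R b = z + (r / (l * N)) *\<^sub>R (b - a)"
        by (simp add: s(3) s'_def algebra_simps)
      then have "l *\<^sub>R ((1 - s') *\<^sub>R a + s' *\<^sub>R b) = l *\<^sub>R z + r *\<^sub>R ?v"
        using l0 by (simp add: scaleR_add_right)
      moreover have "(1 - s') *\<^sub>R a + s' *\<^sub>R b \<in> closed_segment a b" using s' by (auto simp: in_segment)
      ultimately show False using lD r(2) by metis
    qed
    then show ?thesis using lD by auto
  qed (use ab in simp)
qed

locale perturbation = smooth_convex_body L for L :: "(real^'n) set" +
  fixes f g :: "real^'n \<Rightarrow> real"
  assumes dim: "CARD('n) \<ge> 2"
    and curv: "smooth_positive_curvature L"
    and f: "Ck_on 2 f (- {0})" and g: "Ck_on 2 g (- {0})"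
    and f_pos: "x \<noteq> 0 \<Longrightarrow> f x > 0"
    and f_int: "\<lbrakk>x \<in> sphere 0 1; R > 0\<rbrakk> \<Longrightarrow> set_integrable lborel {0<..R} (\<lambda>t. t ^ (CARD('n) - 2) * f (t *\<^sub>R x))"
begin


definition "F x t = t ^ (CARD('n) - 2) * f (t *\<^sub>R x)"
definition "I x r = integral {0..r} (F x)"

lemma open_punctured: "open (- {0::real^'n})"
  by auto

lemma F_integrable:
  assumes "x \<in> sphere 0 1" "r > 0"
  shows "F x integrable_on {0..r}" "(LBINT t:{0<..r}. t ^ (CARD('n) - 2) * f (t *\<^sub>R x)) = I x r"
proof -
  have 1: "set_integrable lborel {0<..r} (F x)" using f_int[OF assms] by (simp add: F_def[abs_def])
  have neg: "negligible {0::real}" by simp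
  have i: "F x integrable_on {0<..r}" using set_borel_integral_eq_integral(1)[OF 1] .
  then show "F x integrable_on {0..r}"
    by (rule integrable_spike_set) (auto intro: negligible_subset[OF neg])
  have "integral {0<..r} (F x) = integral {0..r} (F x)"
    by (rule integral_spike_set) (auto intro: negligible_subset[OF neg])
  then show "(LBINT t:{0<..r}. t ^ (CARD('n) - 2) * f (t *\<^sub>R x)) = I x r"
    using set_borel_integral_eq_integral(2)[OF 1] by (simp add: I_def F_def[abs_def])
qed

lemma continuous_f: "continuous_on (- {0}) f"
  by (rule Ck_on_imp_continuous_on[OF f])

lemma DERIV_I:
  assumes x: "x \<in> sphere 0 1" and r: "r > 0"
  shows "(I x has_real_derivative F x r) (at r)"
proof -
  have "continuous_on {0<..} (F x)"
    unfolding F_def using x by (intro continuous_intros continuous_on_compose2[OF continuous_f]) auto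
  then have "isCont (F x) r" using r by (simp add: continuous_on_eq_continuous_at)
  then have "continuous (at r within {0..r + 1}) (F x)" by (rule continuous_at_imp_continuous_at_within)
  then have "((\<lambda>u. integral {0..u} (F x)) has_vector_derivative F x r) (at r within {0..r + 1})"
    using integral_has_vector_derivative_continuous_at[of "F x" 0 "r + 1" r "{}"] F_integrable(1)[OF x, of "r + 1"] r by simp
  moreover have "at r within {0..r + 1} = at r" by (rule at_within_interior) (use r in simp)
  ultimately show ?thesis by (simp add: I_def[abs_def] has_real_derivative_iff_has_vector_derivative)
qed

lemma F_pos: "\<lbrakk>x \<in> sphere 0 1; r > 0\<rbrakk> \<Longrightarrow> F x r > 0"
  unfolding F_def by (intro mult_pos_pos f_pos) auto

lemma I_strict_mono:
  assumes "x \<in> sphere 0 1" "0 < r" "r < s"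
  shows "I x r < I x s"
proof (rule DERIV_pos_imp_increasing[OF assms(3)])
  fix u assume "r \<le> u"
  then have "u > 0" using assms(2) by simp
  then show "\<exists>y. (I x has_real_derivative y) (at u) \<and> y > 0"
    using DERIV_I F_pos assms(1) by blast
qed

lemma I_le_iff: "\<lbrakk>x \<in> sphere 0 1; 0 < r; 0 < s\<rbrakk> \<Longrightarrow> I x r \<le> I x s \<longleftrightarrow> r \<le> s"
  using I_strict_mono by (metis linorder_not_less order.order_iff_strict)

definition "\<sigma> z = 1 - snd z + snd z * inverse (m (fst z))"
definition "w z = \<sigma> z ^ (CARD('n) - 2) * f (\<sigma> z *\<^sub>R fst z)"
definition "A y = integral {0..1} (\<lambda>t. w (y, t))"
definition "h y = inverse (norm y) ^ (CARD('n) - 1) * g (inverse (norm y) *\<^sub>R y)"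
definition "\<kappa> y = m y * h y / A y"

lemma \<sigma>_pos: "\<lbrakk>y \<noteq> 0; 0 \<le> t; t \<le> 1\<rbrakk> \<Longrightarrow> \<sigma> (y, t) > 0"
proof -
  assume y: "y \<noteq> 0" and t: "0 \<le> t" "t \<le> 1"
  have "inverse (m y) > 0" using m_pos[OF y] by simp
  then have "t * inverse (m y) \<ge> 0" "t > 0 \<Longrightarrow> t * inverse (m y) > 0" using t by auto
  then show ?thesis using t by (cases "t = 0") (auto simp: \<sigma>_def)
qed

lemma
  shows Ck_on_A: "Ck_on 2 A (- {0})"
    and continuous_w: "y \<noteq> 0 \<Longrightarrow> continuous_on {0..1} (\<lambda>t. w (y, t))"
proof -
  let ?P = "(- {0::real^'n}) \<times> (UNIV :: real set)"
  let ?S = "?P \<inter> \<sigma> -` {0<..}"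
  have P: "open ?P" by (intro open_Times) auto
  have C1: "Ck_on k (fst :: _ \<Rightarrow> real^'n) ?P" for k by (rule Ck_on_linear[OF bounded_linear_fst P])
  have C2: "Ck_on k (snd :: (real^'n) \<times> real \<Rightarrow> real) ?P" for k by (rule Ck_on_linear[OF bounded_linear_snd P])
  have Cm: "Ck_on k (\<lambda>z :: (real^'n) \<times> real. m (fst z)) ?P" for k
    by (rule Ck_on_compose[OF P Ck_on_m C1]) auto
  have Cs: "Ck_on k \<sigma> ?P" for k
    unfolding \<sigma>_def[abs_def]
    by (rule Ck_on_add[OF P Ck_on_diff[OF P Ck_on_const C2] Ck_on_mult[OF P C2 Ck_on_inverse[OF P Cm]]])
      (use m_pos in force)
  have S: "open ?S"
    by (rule continuous_open_preimage[OF Ck_on_imp_continuous_on[OF Cs[of 0]] P]) simp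
  have Cs': "Ck_on k \<sigma> ?S" for k by (rule Ck_on_subset[OF Cs]) auto
  have "Ck_on 2 (\<lambda>z. f (\<sigma> z *\<^sub>R fst z)) ?S"
    by (rule Ck_on_compose[OF S f Ck_on_scaleR[OF S Cs' Ck_on_subset[OF C1]]]) auto
  then have Cw: "Ck_on 2 w ?S"
    unfolding w_def[abs_def] by (intro Ck_on_mult S Ck_on_power Cs')
  have sub: "(- {0}) \<times> {0..1} \<subseteq> ?S" using \<sigma>_pos by auto
  show "Ck_on 2 A (- {0})"
    unfolding A_def[abs_def] by (rule Ck_on_integral[OF open_punctured S sub Cw])
  show "continuous_on {0..1} (\<lambda>t. w (y, t))" if "y \<noteq> 0"
    by (rule continuous_on_compose2[OF continuous_on_subset[OF Ck_on_imp_continuous_on[OF Cw] sub]])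
      (use that in \<open>auto intro!: continuous_intros\<close>)
qed

lemma A_pos:
  assumes y: "y \<noteq> 0"
  shows "A y > 0"
proof -
  have "\<exists>t\<in>{0..1::real}. \<forall>s\<in>{0..1}. w (y, t) \<le> w (y, s)"
    by (rule continuous_attains_inf[OF _ _ continuous_w[OF y]]) auto
  then obtain t where t: "t \<in> {0..1}" "\<And>s. s \<in> {0..1} \<Longrightarrow> w (y, t) \<le> w (y, s)" by blast
  have "\<sigma> (y, t) > 0" using \<sigma>_pos[OF y] t(1) by auto
  then have "w (y, t) > 0" using y by (auto simp: w_def intro!: mult_pos_pos f_pos)
  also have "w (y, t) = integral {0..1::real} (\<lambda>_. w (y, t))" by simp
  also have "\<dots> \<le> A y"
    unfolding A_def
    by (rule integral_le) (use t(2) integrable_continuous_interval[OF continuous_w[OF y]] in auto)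
  finally show ?thesis .
qed

lemma Ck_on_\<kappa>: "Ck_on 2 \<kappa> (- {0})"
proof -
  note o = open_punctured
  have i: "Ck_on 2 (\<lambda>y::real^'n. inverse (norm y)) (- {0})"
    by (rule Ck_on_inverse[OF o Ck_on_norm]) auto
  have "Ck_on 2 (\<lambda>y. g (inverse (norm y) *\<^sub>R y)) (- {0})"
    by (rule Ck_on_compose[OF o g Ck_on_scaleR[OF o i Ck_on_linear[OF bounded_linear_ident o]]]) auto
  then have "Ck_on 2 h (- {0})"
    unfolding h_def[abs_def] by (rule Ck_on_mult[OF o Ck_on_power[OF o i]])
  then show ?thesis
    unfolding \<kappa>_def[abs_def]
    by (rule Ck_on_divide[OF o Ck_on_mult[OF o Ck_on_2_m] Ck_on_A]) (use A_pos in force)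
qed

definition "E \<epsilon> y = m y + \<epsilon> * \<kappa> y"
definition "T \<epsilon> x = I x (radial L x) - \<epsilon> * g x"

lemma Ck_on_E: "Ck_on 2 (E \<epsilon>) (- {0})"
  unfolding E_def[abs_def]
  by (rule Ck_on_add[OF open_punctured Ck_on_2_m Ck_on_mult[OF open_punctured Ck_on_const Ck_on_\<kappa>]])

text \<open>The substitution \<open>s = t (1 - \<tau> + \<tau> / m y)\<close> maps \<open>[0, 1]\<close> onto the segment between \<open>t\<close> and
  the radial function of \<open>L\<close>. It turns the defining equation of \<open>D\<close> into \<open>m + \<epsilon> \<kappa> = 1\<close>, which
  involves \<open>f\<close> only away from the origin, where it is \<open>C\<^sup>2\<close>.\<close>

lemma I_difference:
  assumes x: "x \<in> sphere 0 1" and t: "t > 0"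
  shows "I x (radial L x) - I x t = t ^ (CARD('n) - 1) * (inverse (m (t *\<^sub>R x)) - 1) * A (t *\<^sub>R x)"
proof -
  let ?y = "t *\<^sub>R x"
  have x0: "x \<noteq> 0" using x by auto
  have y: "?y \<noteq> 0" using x0 t by simp
  let ?c = "t ^ (CARD('n) - 1) * (inverse (m ?y) - 1)"
  have tn: "t ^ (CARD('n) - 1) = t * t ^ (CARD('n) - 2)"
  proof -
    have "CARD('n) - 1 = Suc (CARD('n) - 2)" using dim by simp
    then show ?thesis by (simp only: power_Suc)
  qed
  have "((\<lambda>u. I x (t * \<sigma> (?y, u))) has_vector_derivative ?c * w (?y, u)) (at u within {0..1})"
    if u: "u \<in> {0..1}" for u
  proof -
    have "t * \<sigma> (?y, u) > 0" using \<sigma>_pos[OF y] u t by simp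
    note D = DERIV_I[OF x this]
    have "((\<lambda>u. t * \<sigma> (?y, u)) has_real_derivative t * (inverse (m ?y) - 1)) (at u)"
      unfolding \<sigma>_def by (auto intro!: derivative_eq_intros simp: algebra_simps)
    from DERIV_chain2[OF D this]
    have "((\<lambda>u. I x (t * \<sigma> (?y, u))) has_real_derivative F x (t * \<sigma> (?y, u)) * (t * (inverse (m ?y) - 1))) (at u)" .
    moreover have "F x (t * \<sigma> (?y, u)) * (t * (inverse (m ?y) - 1)) = ?c * w (?y, u)"
      by (simp add: F_def w_def tn[unfolded One_nat_def] power_mult_distrib mult_ac)
    ultimately show ?thesis
      by (simp add: has_real_derivative_iff_has_vector_derivative has_vector_derivative_at_within)
  qed
  then have "((\<lambda>u. ?c * w (?y, u)) has_integral I x (t * \<sigma> (?y, 1)) - I x (t * \<sigma> (?y, 0))) {0..1}"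
    by (intro fundamental_theorem_of_calculus) auto
  moreover have "((\<lambda>u. ?c * w (?y, u)) has_integral ?c * A ?y) {0..1}"
    unfolding A_def
    by (intro has_integral_mult_right integrable_integral integrable_continuous_interval continuous_w y)
  ultimately have "I x (t * \<sigma> (?y, 1)) - I x (t * \<sigma> (?y, 0)) = ?c * A ?y"
    by (rule has_integral_unique)
  moreover have "t * \<sigma> (?y, 1) = radial L x"
    using t m_scale[of t x] by (simp add: \<sigma>_def radial_def)
  moreover have "\<sigma> (?y, 0) = 1" by (simp add: \<sigma>_def)
  ultimately show ?thesis by simp
qed

lemma T_minus_I:
  assumes x: "x \<in> sphere 0 1" and t: "t > 0"
  obtains c where "c > 0" "T \<epsilon> x - I x t = c * (1 - E \<epsilon> (t *\<^sub>R x))"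
proof
  let ?y = "t *\<^sub>R x"
  have y: "?y \<noteq> 0" using x t by auto
  note pos = m_pos[OF y] A_pos[OF y]
  let ?c = "t ^ (CARD('n) - 1) * (A ?y / m ?y)"
  show "?c > 0" using pos t by simp
  have "h ?y = inverse (t ^ (CARD('n) - 1)) * g x"
    using x t by (simp add: h_def power_inverse)
  then have g: "g x = t ^ (CARD('n) - 1) * h ?y" using t by simp
  have "T \<epsilon> x - I x t = t ^ (CARD('n) - 1) * ((inverse (m ?y) - 1) * A ?y - \<epsilon> * h ?y)"
    using I_difference[OF x t] by (simp add: T_def g algebra_simps)
  also have "(inverse (m ?y) - 1) * A ?y - \<epsilon> * h ?y = A ?y / m ?y * (1 - E \<epsilon> ?y)"
    using pos by (simp add: E_def \<kappa>_def field_simps)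
  finally show "T \<epsilon> x - I x t = ?c * (1 - E \<epsilon> ?y)" by simp
qed

lemma E_iff:
  assumes x: "x \<in> sphere 0 1" and t: "t > 0"
  shows "E \<epsilon> (t *\<^sub>R x) \<le> 1 \<longleftrightarrow> I x t \<le> T \<epsilon> x" "E \<epsilon> (t *\<^sub>R x) < 1 \<longleftrightarrow> I x t < T \<epsilon> x"
proof -
  obtain c where c: "c > 0" "T \<epsilon> x - I x t = c * (1 - E \<epsilon> (t *\<^sub>R x))" using T_minus_I[OF assms] by metis
  have "I x t \<le> T \<epsilon> x \<longleftrightarrow> 0 \<le> c * (1 - E \<epsilon> (t *\<^sub>R x))" "I x t < T \<epsilon> x \<longleftrightarrow> 0 < c * (1 - E \<epsilon> (t *\<^sub>R x))"
    by (simp_all flip: c(2))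
  then show "E \<epsilon> (t *\<^sub>R x) \<le> 1 \<longleftrightarrow> I x t \<le> T \<epsilon> x" "E \<epsilon> (t *\<^sub>R x) < 1 \<longleftrightarrow> I x t < T \<epsilon> x"
    using c(1) by (simp_all add: zero_le_mult_iff zero_less_mult_iff)
qed

lemma E_shrink:
  assumes "y \<noteq> 0" "0 < u" "u < 1" "E \<epsilon> y \<le> 1"
  shows "E \<epsilon> (u *\<^sub>R y) < 1"
proof -
  define x t where "x = inverse (norm y) *\<^sub>R y" and "t = norm y"
  have x: "x \<in> sphere 0 1" and t: "t > 0" and y: "y = t *\<^sub>R x"
    using assms(1) by (auto simp: x_def t_def)
  have "I x (u * t) < I x t" by (rule I_strict_mono[OF x]) (use assms t in auto)
  also have "I x t \<le> T \<epsilon> x" using E_iff(1)[OF x t] assms(4) y by simp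
  finally show ?thesis using E_iff(2)[OF x, of "u * t"] assms(2) t by (simp add: y)
qed

definition "annulus = {y. 1/2 \<le> m y \<and> m y \<le> 2}"
definition "body \<epsilon> = insert 0 {y. y \<noteq> 0 \<and> E \<epsilon> y \<le> 1}"

lemma annulus_nonzero: "y \<in> annulus \<Longrightarrow> y \<noteq> 0"
  by (auto simp: annulus_def)

lemma compact_annulus: "compact annulus"
proof -
  have "annulus \<subseteq> (\<lambda>y. 2 *\<^sub>R y) ` L"
  proof
    fix y assume y: "y \<in> annulus"
    then have "inverse 2 *\<^sub>R y \<in> L"
      using minkowski_le_iff[OF star annulus_nonzero[OF y], of 2] by (simp add: annulus_def)
    then show "y \<in> (\<lambda>y. 2 *\<^sub>R y) ` L" by (rule rev_image_eqI) simp
  qed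
  moreover have "bounded ((\<lambda>y. 2 *\<^sub>R y) ` L)"
    using star by (intro bounded_scaling compact_imp_bounded) (simp add: star_body_def)
  moreover have "closed annulus"
    unfolding annulus_def by (intro closed_Collect_conj closed_Collect_le continuous_m continuous_intros)
  ultimately show ?thesis using bounded_subset compact_eq_bounded_closed by blast
qed

lemma perturbed_radial_eq_unique:
  assumes D: "star_body D" "perturbed_radial_eq f g L \<epsilon> D"
  shows "D = body \<epsilon>"
proof (rule set_eqI)
  fix y
  have "0 \<in> D" using D(1) interior_subset by (auto simp: star_body_def)
  show "y \<in> D \<longleftrightarrow> y \<in> body \<epsilon>"
  proof (cases "y = 0")
    case False
    define x t where "x = inverse (norm y) *\<^sub>R y" and "t = norm y"
    have x: "x \<in> sphere 0 1" and t: "t > 0" and y: "y = t *\<^sub>R x"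
      using False by (auto simp: x_def t_def)
    have x0: "x \<noteq> 0" using x by auto
    note rp = radial_pos[OF D(1) x0] radial_pos[OF star x0]
    have "I x (radial D x) = T \<epsilon> x"
      using D(2) x F_integrable(2)[OF x rp(1)] F_integrable(2)[OF x rp(2)]
      by (simp add: perturbed_radial_eq_def T_def)
    then have "E \<epsilon> y \<le> 1 \<longleftrightarrow> t \<le> radial D x"
      using E_iff(1)[OF x t] I_le_iff[OF x t rp(1)] y by simp
    also have "\<dots> \<longleftrightarrow> y \<in> D" using le_radial_iff[OF D(1) x0 t] y by simp
    finally show ?thesis using False by (simp add: body_def)
  qed (use \<open>0 \<in> D\<close> in \<open>simp add: body_def\<close>)
qed

lemma open_E_less: "open {y. y \<noteq> 0 \<and> E \<epsilon> y < 1}"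
proof -
  have "open ((- {0}) \<inter> E \<epsilon> -` {..<1})"
    by (rule continuous_open_preimage[OF Ck_on_imp_continuous_on[OF Ck_on_E]]) auto
  moreover have "(- {0}) \<inter> E \<epsilon> -` {..<1} = {y. y \<noteq> 0 \<and> E \<epsilon> y < 1}" by auto
  ultimately show ?thesis by simp
qed

context
  fixes \<epsilon> C :: real
  assumes \<epsilon>: "\<epsilon> > 0" "\<epsilon> * C < 1 / 2"
    and C: "\<And>y. y \<in> annulus \<Longrightarrow> \<bar>\<kappa> y\<bar> \<le> C"
begin

lemma \<epsilon>\<kappa>: "y \<in> annulus \<Longrightarrow> \<bar>\<epsilon> * \<kappa> y\<bar> < 1 / 2"
proof -
  assume "y \<in> annulus"
  then have "\<epsilon> * \<bar>\<kappa> y\<bar> \<le> \<epsilon> * C" using C \<epsilon>(1) by simp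
  moreover have "\<bar>\<epsilon> * \<kappa> y\<bar> = \<epsilon> * \<bar>\<kappa> y\<bar>" using \<epsilon>(1) by (simp add: abs_mult)
  ultimately show ?thesis using \<epsilon>(2) by linarith
qed

lemma E_inside:
  assumes "y \<noteq> 0" "m y \<le> 1 / 2"
  shows "E \<epsilon> y < 1"
proof (cases "m y = 1/2")
  case True
  then show ?thesis using \<epsilon>\<kappa>[of y] by (simp add: annulus_def E_def)
next
  case False
  let ?u = "2 * m y"
  have u: "0 < ?u" "?u < 1" using m_pos[OF assms(1)] assms(2) False by auto
  have mz: "m (inverse ?u *\<^sub>R y) = 1/2" using m_scale[of "inverse ?u" y] u m_pos[OF assms(1)] by simp
  then have "\<bar>\<epsilon> * \<kappa> (inverse ?u *\<^sub>R y)\<bar> < 1/2" by (intro \<epsilon>\<kappa>) (simp add: annulus_def)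
  then have "E \<epsilon> (inverse ?u *\<^sub>R y) \<le> 1" unfolding E_def mz by linarith
  from E_shrink[OF _ u this] assms(1) u show ?thesis by simp
qed

lemma E_outside:
  assumes "2 \<le> m y"
  shows "1 < E \<epsilon> y"
proof (rule ccontr)
  assume not: "\<not> 1 < E \<epsilon> y"
  have y: "y \<noteq> 0" using assms by auto
  let ?u = "2 / m y"
  have u: "0 < ?u" "?u \<le> 1" using assms by auto
  have mz: "m (?u *\<^sub>R y) = 2" using m_scale[of ?u y] u y m_pos[OF y] by simp
  then have "\<bar>\<epsilon> * \<kappa> (?u *\<^sub>R y)\<bar> < 1/2" by (intro \<epsilon>\<kappa>) (simp add: annulus_def)
  then have "1 < E \<epsilon> (?u *\<^sub>R y)" unfolding E_def mz by linarith
  moreover have "E \<epsilon> (?u *\<^sub>R y) \<le> 1"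
  proof (cases "?u = 1")
    case True
    then show ?thesis using not by simp
  next
    case False
    then have "?u < 1" using u(2) by linarith
    then show ?thesis using E_shrink[OF y u(1), of \<epsilon>] not by simp
  qed
  ultimately show False by simp
qed

lemma body_alt: "body \<epsilon> = {y. m y \<le> 1/2} \<union> (annulus \<inter> {y. E \<epsilon> y \<le> 1})"
proof (rule set_eqI)
  fix y
  have "m y \<le> 2" if "E \<epsilon> y \<le> 1" using E_outside[of y] that by linarith
  then show "y \<in> body \<epsilon> \<longleftrightarrow> y \<in> {y. m y \<le> 1/2} \<union> (annulus \<inter> {y. E \<epsilon> y \<le> 1})"
    using E_inside[of y] by (cases "y = 0") (auto simp: body_def annulus_def)
qed

lemma closed_body: "closed (body \<epsilon>)"
proof -
  have "continuous_on annulus (E \<epsilon>)"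
    by (rule continuous_on_subset[OF Ck_on_imp_continuous_on[OF Ck_on_E]]) (use annulus_nonzero in auto)
  then have "closed (annulus \<inter> E \<epsilon> -` {..1})"
    by (rule continuous_closed_preimage) (use compact_annulus compact_imp_closed in auto)
  moreover have "closed {y. m y \<le> 1/2}"
    by (intro closed_Collect_le continuous_m continuous_intros)
  moreover have "E \<epsilon> -` {..1} = {y. E \<epsilon> y \<le> 1}" by auto
  ultimately show ?thesis by (simp add: body_alt closed_Un)
qed

lemma zero_interior_body: "0 \<in> interior (body \<epsilon>)"
  by (rule interiorI[OF open_m_less[of "1/2"]]) (auto simp: body_alt)

lemma mem_interior_body: "\<lbrakk>y \<noteq> 0; E \<epsilon> y < 1\<rbrakk> \<Longrightarrow> y \<in> interior (body \<epsilon>)"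
  by (rule interiorI[OF open_E_less[of \<epsilon>]]) (auto simp: body_def)

lemma body_shrink:
  assumes "y \<in> body \<epsilon>" "0 \<le> u" "u < 1"
  shows "u *\<^sub>R y \<in> interior (body \<epsilon>)"
proof (cases "y = 0 \<or> u = 0")
  case True
  then show ?thesis using zero_interior_body by auto
next
  case False
  then show ?thesis
    using assms E_shrink[of y u \<epsilon>] by (intro mem_interior_body) (auto simp: body_def)
qed

lemma star_body_body: "star_body (body \<epsilon>)"
  unfolding star_body_def
proof (intro conjI ballI zero_interior_body subsetI)
  have "body \<epsilon> \<subseteq> (\<lambda>y. 2 *\<^sub>R y) ` L"
  proof
    fix y assume "y \<in> body \<epsilon>"
    then have "m y \<le> 2" by (auto simp: body_alt annulus_def)
    then have "inverse 2 *\<^sub>R y \<in> L"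
      using minkowski_le_iff[OF star, of y 2] zero_mem by (cases "y = 0") auto
    then show "y \<in> (\<lambda>y. 2 *\<^sub>R y) ` L" by (rule rev_image_eqI) simp
  qed
  moreover have "bounded ((\<lambda>y. 2 *\<^sub>R y) ` L)"
    using star by (intro bounded_scaling compact_imp_bounded) (simp add: star_body_def)
  ultimately show "compact (body \<epsilon>)"
    using closed_body bounded_subset compact_eq_bounded_closed by blast
  fix y z assume y: "y \<in> body \<epsilon>" and "z \<in> closed_segment 0 y"
  then obtain u where u: "0 \<le> u" "u \<le> 1" "z = u *\<^sub>R y" by (auto simp: in_segment)
  show "z \<in> body \<epsilon>"
    using body_shrink[OF y u(1)] interior_subset u y by (cases "u = 1") auto
qed

lemma perturbed_radial_eq_body: "perturbed_radial_eq f g L \<epsilon> (body \<epsilon>)"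
  unfolding perturbed_radial_eq_def
proof
  fix x :: "real^'n" assume x: "x \<in> sphere 0 1"
  then have x0: "x \<noteq> 0" by auto
  let ?R = "radial (body \<epsilon>) x"
  note rp = radial_pos[OF star_body_body x0] radial_pos[OF star x0]
  have iff: "I x t \<le> T \<epsilon> x \<longleftrightarrow> t \<le> ?R" if "t > 0" for t
    using le_radial_iff[OF star_body_body x0 that] E_iff(1)[OF x that] x0 that by (simp add: body_def)
  have "I x ?R = T \<epsilon> x"
  proof (rule ccontr)
    assume "I x ?R \<noteq> T \<epsilon> x"
    then have "I x ?R < T \<epsilon> x" using iff[OF rp(1)] by simp
    moreover have "isCont (I x) ?R" using DERIV_isCont[OF DERIV_I[OF x rp(1)]] .
    ultimately have "eventually (\<lambda>t. I x t < T \<epsilon> x) (at ?R)"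
      using order_tendstoD(2) isCont_def by blast
    then obtain d where d: "d > 0" "\<And>t. \<lbrakk>t \<noteq> ?R; dist t ?R < d\<rbrakk> \<Longrightarrow> I x t < T \<epsilon> x"
      by (auto simp: eventually_at)
    have "I x (?R + d/2) < T \<epsilon> x" by (rule d(2)) (use d(1) in \<open>auto simp: dist_real_def\<close>)
    then show False using iff[of "?R + d/2"] rp(1) d(1) by simp
  qed
  then show "(LBINT t:{0<..?R}. t ^ (CARD('n) - 2) * f (t *\<^sub>R x)) =
     (LBINT t:{0<..radial L x}. t ^ (CARD('n) - 2) * f (t *\<^sub>R x)) - \<epsilon> * g x"
    using F_integrable(2)[OF x rp(1)] F_integrable(2)[OF x rp(2)] by (simp add: T_def)
qed

lemma convex_body_of_curved:
  assumes curved: "\<And>q v. \<lbrakk>q \<in> annulus; norm v = 1; dderiv (E \<epsilon>) v q = 0\<rbrakk> \<Longrightarrow> dderiv (dderiv (E \<epsilon>) v) v q > 0"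
  shows "convex (body \<epsilon>)"
proof (rule convex_if_no_inner_touching[OF closed_body body_shrink])
  fix q v :: "real^'n" and d :: real
  assume q: "q \<in> body \<epsilon>" "q \<notin> interior (body \<epsilon>)" and v: "norm v = 1" and d: "d > 0"
  have q0: "q \<noteq> 0" using q(2) zero_interior_body by auto
  have Eq: "E \<epsilon> q = 1" using mem_interior_body[OF q0] q q0 by (force simp: body_def)
  have qa: "q \<in> annulus" using q(1) E_inside[OF q0] Eq by (auto simp: body_alt)
  obtain d' where d': "d' > 0" "\<And>r. \<bar>r\<bar> < d' \<Longrightarrow> q + r *\<^sub>R v \<noteq> 0" using line_avoids_zero[OF q0] by blast
  show "\<exists>r. \<bar>r\<bar> < d \<and> q + r *\<^sub>R v \<notin> body \<epsilon>"
  proof (rule ccontr)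
    assume not: "\<nexists>r. \<bar>r\<bar> < d \<and> q + r *\<^sub>R v \<notin> body \<epsilon>"
    have "E \<epsilon> (q + r *\<^sub>R v) \<le> E \<epsilon> q" if "\<bar>r\<bar> < min d d'" for r
    proof -
      have "q + r *\<^sub>R v \<in> body \<epsilon>" "q + r *\<^sub>R v \<noteq> 0" using not that d'(2) by auto
      then show ?thesis using Eq by (simp add: body_def)
    qed
    moreover have "q \<in> - {0}" "min d d' > 0" using q0 d d'(1) by auto
    ultimately have "dderiv (E \<epsilon>) v q = 0" "dderiv (dderiv (E \<epsilon>) v) v q \<le> 0"
      using dderiv_local_max_on_line[OF Ck_on_E open_punctured] by blast+
    then show False using curved[OF qa v] by simp
  qed
qed

end

lemma dderiv_E:
  assumes y: "y \<noteq> 0"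
  shows "dderiv (E \<epsilon>) v y = dderiv m v y + \<epsilon> * dderiv \<kappa> v y"
    and "dderiv (dderiv (E \<epsilon>) v) v y = dderiv (dderiv m v) v y + \<epsilon> * dderiv (dderiv \<kappa> v) v y"
proof -
  have K: "Ck_on (Suc 1) \<kappa> (- {0})" using Ck_on_\<kappa> by (simp add: numeral_2_eq_2)
  have K1: "Ck_on (Suc 0) (dderiv \<kappa> v) (- {0})" using Ck_on_dderiv[OF K] by simp
  have 1: "(E \<epsilon> has_derivative (\<lambda>v. dderiv m v y + \<epsilon> * dderiv \<kappa> v y)) (at y)" if "y \<noteq> 0" for y
    unfolding E_def
    using that by (intro has_derivative_add has_derivative_mult_right has_derivative_dderiv[OF Ck_on_m[of "Suc 0"]] has_derivative_dderiv[OF K]) auto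
  then have eq: "dderiv (E \<epsilon>) v y = dderiv m v y + \<epsilon> * dderiv \<kappa> v y" if "y \<noteq> 0" for v y
    using dderiv_eqI that by blast
  then show "dderiv (E \<epsilon>) v y = dderiv m v y + \<epsilon> * dderiv \<kappa> v y" using y by blast
  have "((\<lambda>y. dderiv m v y + \<epsilon> * dderiv \<kappa> v y) has_derivative
      (\<lambda>w. dderiv (dderiv m v) w y + \<epsilon> * dderiv (dderiv \<kappa> v) w y)) (at y)"
    using y by (intro has_derivative_add has_derivative_mult_right has_derivative_dderiv[OF Ck_on_Dm[of "Suc 0"]] has_derivative_dderiv[OF K1]) auto
  then have "(dderiv (E \<epsilon>) v has_derivative
      (\<lambda>w. dderiv (dderiv m v) w y + \<epsilon> * dderiv (dderiv \<kappa> v) w y)) (at y)"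
    by (rule has_derivative_transform_within_open[OF _ open_punctured]) (use y eq in auto)
  then show "dderiv (dderiv (E \<epsilon>) v) v y = dderiv (dderiv m v) v y + \<epsilon> * dderiv (dderiv \<kappa> v) v y"
    by (rule dderiv_eqI)
qed

lemma bounded_on_annulus_sphere:
  fixes \<Phi> :: "(real^'n) \<times> (real^'n) \<Rightarrow> real"
  assumes "continuous_on ((- {0}) \<times> UNIV) \<Phi>"
  obtains B where "B > 0" "\<And>q v. \<lbrakk>q \<in> annulus; norm v = 1\<rbrakk> \<Longrightarrow> \<bar>\<Phi> (q, v)\<bar> \<le> B"
proof -
  have "continuous_on (annulus \<times> sphere 0 1) \<Phi>"
    by (rule continuous_on_subset[OF assms]) (use annulus_nonzero in auto)
  then have "bounded (\<Phi> ` (annulus \<times> sphere 0 1))"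
    by (intro compact_imp_bounded compact_continuous_image compact_Times compact_annulus) auto
  then obtain B where "B > 0" "\<forall>z\<in>\<Phi> ` (annulus \<times> sphere 0 1). norm z \<le> B"
    unfolding bounded_pos by blast
  then show ?thesis by (intro that[of B]) auto
qed

lemma uniform_curvature:
  obtains c where "c > 0" "\<And>q v. \<lbrakk>q \<in> annulus; norm v = 1\<rbrakk> \<Longrightarrow> c \<le> \<bar>dderiv m v q\<bar> + dderiv (dderiv m v) v q"
proof (cases "annulus \<times> sphere (0::real^'n) 1 = {}")
  case True
  then show ?thesis by (intro that[of 1]) auto
next
  case False
  let ?\<Phi> = "\<lambda>z. \<bar>dderiv m (snd z) (fst z)\<bar> + dderiv (dderiv m (snd z)) (snd z) (fst z)"
  have "continuous_on ((- {0}) \<times> UNIV) ?\<Phi>"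
    by (intro continuous_intros continuous_on_dderiv_pair[OF Ck_on_m] continuous_on_dderiv2_pair[OF open_punctured Ck_on_2_m])
  then have "continuous_on (annulus \<times> sphere 0 1) ?\<Phi>"
    by (rule continuous_on_subset) (use annulus_nonzero in auto)
  then obtain z where z: "z \<in> annulus \<times> sphere 0 1" "\<And>z'. z' \<in> annulus \<times> sphere 0 1 \<Longrightarrow> ?\<Phi> z \<le> ?\<Phi> z'"
    using continuous_attains_inf[OF compact_Times[OF compact_annulus compact_sphere] False] by blast
  have y: "fst z \<noteq> 0" "snd z \<noteq> 0" using z(1) annulus_nonzero by auto
  have "?\<Phi> z > 0"
    using second_derivative_pos[OF star conv curv y] D2m_nonneg[OF y(1), of "snd z"]
    by (cases "dderiv m (snd z) (fst z) = 0") auto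
  then show ?thesis using z(2) by (intro that[of "?\<Phi> z"]) force+
qed

lemma small_perturbation_convex:
  "\<exists>\<epsilon>\<^sub>0>0. \<forall>\<epsilon>. 0 < \<epsilon> \<and> \<epsilon> < \<epsilon>\<^sub>0 \<longrightarrow>
    star_body (body \<epsilon>) \<and> perturbed_radial_eq f g L \<epsilon> (body \<epsilon>) \<and> convex (body \<epsilon>)"
proof -
  have K: "Ck_on (Suc 1) \<kappa> (- {0})" using Ck_on_\<kappa> by (simp add: numeral_2_eq_2)
  obtain c where c: "c > 0" "\<And>q v. \<lbrakk>q \<in> annulus; norm v = 1\<rbrakk> \<Longrightarrow> c \<le> \<bar>dderiv m v q\<bar> + dderiv (dderiv m v) v q"
    using uniform_curvature by blast
  have "continuous_on ((- {0}) \<times> UNIV) (\<lambda>z::(real^'n) \<times> (real^'n). \<kappa> (fst z))"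
    by (rule continuous_on_compose2[OF Ck_on_imp_continuous_on[OF K]]) (auto intro: continuous_intros)
  then obtain B0 where B0: "B0 > 0" "\<And>q v::real^'n. \<lbrakk>q \<in> annulus; norm v = 1\<rbrakk> \<Longrightarrow> \<bar>\<kappa> q\<bar> \<le> B0"
    using bounded_on_annulus_sphere by (metis fst_conv)
  obtain B1 where B1: "B1 > 0" "\<And>q v. \<lbrakk>q \<in> annulus; norm v = 1\<rbrakk> \<Longrightarrow> \<bar>dderiv \<kappa> v q\<bar> \<le> B1"
    using bounded_on_annulus_sphere[OF continuous_on_dderiv_pair[OF K]] by (metis fst_conv snd_conv)
  obtain B2 where B2: "B2 > 0" "\<And>q v. \<lbrakk>q \<in> annulus; norm v = 1\<rbrakk> \<Longrightarrow> \<bar>dderiv (dderiv \<kappa> v) v q\<bar> \<le> B2"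
    using bounded_on_annulus_sphere[OF continuous_on_dderiv2_pair[OF open_punctured Ck_on_\<kappa>]] by (metis fst_conv snd_conv)
  define \<epsilon>\<^sub>0 where "\<epsilon>\<^sub>0 = min (1 / (2 * B0)) (c / (B1 + B2))"
  have "\<epsilon>\<^sub>0 > 0" using B0(1) B1(1) B2(1) c(1) by (simp add: \<epsilon>\<^sub>0_def)
  moreover have "star_body (body \<epsilon>) \<and> perturbed_radial_eq f g L \<epsilon> (body \<epsilon>) \<and> convex (body \<epsilon>)"
    if \<epsilon>: "0 < \<epsilon>" "\<epsilon> < \<epsilon>\<^sub>0" for \<epsilon>
  proof -
    have "\<epsilon> < 1 / (2 * B0)" "\<epsilon> < c / (B1 + B2)" using \<epsilon> by (auto simp: \<epsilon>\<^sub>0_def)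
    then have e: "\<epsilon> * B0 < 1 / 2" "\<epsilon> * (B1 + B2) < c"
      using B0(1) B1(1) B2(1) by (simp_all add: field_simps add_pos_pos)
    have \<kappa>B: "\<bar>\<kappa> y\<bar> \<le> B0" if "y \<in> annulus" for y
      using B0(2)[OF that, of "axis undefined 1"] by (simp add: norm_axis_1)
    have "dderiv (dderiv (E \<epsilon>) v) v q > 0"
      if q: "q \<in> annulus" and v: "norm v = 1" and z: "dderiv (E \<epsilon>) v q = 0" for q v
    proof -
      note d = dderiv_E[OF annulus_nonzero[OF q], of \<epsilon> v]
      have "\<bar>dderiv m v q\<bar> = \<epsilon> * \<bar>dderiv \<kappa> v q\<bar>"
        using z \<epsilon>(1) unfolding d(1) by (metis abs_minus_cancel abs_mult abs_of_pos add_eq_0_iff)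
      also have "\<dots> \<le> \<epsilon> * B1" using B1(2)[OF q v] \<epsilon>(1) by simp
      finally have 1: "\<bar>dderiv m v q\<bar> \<le> \<epsilon> * B1" .
      have "\<epsilon> * \<bar>dderiv (dderiv \<kappa> v) v q\<bar> \<le> \<epsilon> * B2" using B2(2)[OF q v] \<epsilon>(1) by simp
      then have "\<bar>\<epsilon> * dderiv (dderiv \<kappa> v) v q\<bar> \<le> \<epsilon> * B2" using \<epsilon>(1) by (simp add: abs_mult)
      then show ?thesis
        unfolding d(2) using 1 c(2)[OF q v] e(2)[unfolded distrib_left] by linarith
    qed
    then show ?thesis
      using star_body_body[OF \<epsilon>(1) e(1) \<kappa>B] perturbed_radial_eq_body[OF \<epsilon>(1) e(1) \<kappa>B]
        convex_body_of_curved[OF \<epsilon>(1) e(1) \<kappa>B] by blast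
  qed
  ultimately show ?thesis by blast
qed

end

theorem proposition2:
  fixes L :: "(real^'n) set" and f g :: "real^'n \<Rightarrow> real"
  assumes "CARD('n) \<ge> 2"
    and "convex_body L" and "origin_symmetric L" and "smooth_positive_curvature L"
    and "Ck_on 2 f (- {0})" and "Ck_on 2 g (- {0})"
    and "\<forall>x. x \<noteq> 0 \<longrightarrow> f (- x) = f x" and "\<forall>x. x \<noteq> 0 \<longrightarrow> g (- x) = g x"
    and "\<forall>x. x \<noteq> 0 \<longrightarrow> f x > 0"
    and "\<forall>x\<in>sphere 0 1. \<forall>R>0. set_integrable lborel {0<..R} (\<lambda>t. t ^ (CARD('n) - 2) * f (t *\<^sub>R x))"
  shows "\<exists>\<epsilon>\<^sub>0>0. \<forall>\<epsilon>. 0 < \<epsilon> \<and> \<epsilon> < \<epsilon>\<^sub>0 \<longrightarrow>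
      (\<exists>D. star_body D \<and> perturbed_radial_eq f g L \<epsilon> D) \<and>
      (\<forall>D. star_body D \<and> perturbed_radial_eq f g L \<epsilon> D \<longrightarrow> convex D)"
proof -
  interpret perturbation L f g
    using assms(1-6,9) assms(10)[rule_format] star_body_of_symmetric_convex_body[OF assms(2,3)]
    by unfold_locales (simp_all add: convex_body_def smooth_positive_curvature_def)
  obtain \<epsilon>\<^sub>0 where "\<epsilon>\<^sub>0 > 0" and small: "\<And>\<epsilon>. \<lbrakk>0 < \<epsilon>; \<epsilon> < \<epsilon>\<^sub>0\<rbrakk> \<Longrightarrow>
      star_body (body \<epsilon>) \<and> perturbed_radial_eq f g L \<epsilon> (body \<epsilon>) \<and> convex (body \<epsilon>)"
    using small_perturbation_convex by blast
  show ?thesis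
  proof (intro exI[of _ \<epsilon>\<^sub>0] conjI \<open>\<epsilon>\<^sub>0 > 0\<close> allI impI; (elim conjE)?)
    fix \<epsilon> assume "0 < \<epsilon>" "\<epsilon> < \<epsilon>\<^sub>0"
    note s = small[OF this]
    show "\<exists>D. star_body D \<and> perturbed_radial_eq f g L \<epsilon> D" using s by blast
    show "convex D" if "star_body D" "perturbed_radial_eq f g L \<epsilon> D" for D
      using perturbed_radial_eq_unique[OF that] s by simp
  qed
qed

end
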